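(* Let $j:V\to M$ be an elementary embedding of $V$ into an inner model $M$. Then $V=\mathrm{HOD}(M)$, i.e. every set in $V$ is definable in $V$ using ordinal parameters and parameters from $M$. Furthermore, every set in $V$ is definable in $V$ using a parameter from the range of $j$.
   Context: Work in NGBC. An inner model is a transitive proper class model of ZF containing all ordinals. For a class $A$, $\mathrm{HOD}(A)$ is the class of sets that are hereditarily definable using ordinal parameters and parameters from $A$; $A$ is not used as a predicate. An elementary embedding $j:V\to M$ means a $\Delta_0$-elementary cofinal map: for every $y\in M$ there is $x$ with $y\in j(x)$. *)

theory Defs
  imports Main
begin

text \<open>
  A model of class theory is given by a type \<open>'v\<close> of sets, a binary relation \<open>E\<close> on it
  (\<open>E x y\<close> is read \<open>x \<in> y\<close>; it need not be well-founded in the metatheory), and a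
  family \<open>\<C>\<close> of subsets of \<open>'v\<close>, the classes. By extensionality for classes every model
  of class theory has this form up to isomorphism.
\<close>

subsection \<open>Formulas\<close>

text \<open>
  \<open>InCls n k\<close> says that the set variable \<open>n\<close> belongs to the class variable \<open>k\<close>. Only set
  variables are quantified, so these are the predicative formulas of class theory.
\<close>

datatype fm =
    Mem nat nat
  | Eq nat nat
  | InCls nat nat
  | Neg fm
  | And fm fm
  | Ex nat fm

primrec set_formula :: "fm \<Rightarrow> bool" where
  "set_formula (Mem m n) = True"
| "set_formula (Eq m n) = True"
| "set_formula (InCls n k) = False"
| "set_formula (Neg p) = set_formula p"
| "set_formula (And p q) = (set_formula p \<and> set_formula q)"
| "set_formula (Ex n p) = set_formula p"

primrec fv :: "fm \<Rightarrow> nat set" where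
  "fv (Mem m n) = {m, n}"
| "fv (Eq m n) = {m, n}"
| "fv (InCls n k) = {n}"
| "fv (Neg p) = fv p"
| "fv (And p q) = fv p \<union> fv q"
| "fv (Ex n p) = fv p - {n}"

inductive delta0 :: "fm \<Rightarrow> bool" where
  "delta0 (Mem m n)"
| "delta0 (Eq m n)"
| "delta0 p \<Longrightarrow> delta0 (Neg p)"
| "delta0 p \<Longrightarrow> delta0 q \<Longrightarrow> delta0 (And p q)"
| "n \<noteq> m \<Longrightarrow> delta0 p \<Longrightarrow> delta0 (Ex n (And (Mem n m) p))"

primrec csat :: "'v set \<Rightarrow> ('v \<Rightarrow> 'v \<Rightarrow> bool) \<Rightarrow> (nat \<Rightarrow> 'v set) \<Rightarrow> (nat \<Rightarrow> 'v) \<Rightarrow> fm \<Rightarrow> bool" where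
  "csat D E P s (Mem m n) = E (s m) (s n)"
| "csat D E P s (Eq m n) = (s m = s n)"
| "csat D E P s (InCls n k) = (s n \<in> P k)"
| "csat D E P s (Neg p) = (\<not> csat D E P s p)"
| "csat D E P s (And p q) = (csat D E P s p \<and> csat D E P s q)"
| "csat D E P s (Ex n p) = (\<exists>a\<in>D. csat D E P (s(n := a)) p)"

text \<open>
  Truth of a set formula in \<open>(D, E)\<close>; class variables do not occur, so their value is immaterial.
\<close>

abbreviation sat :: "'v set \<Rightarrow> ('v \<Rightarrow> 'v \<Rightarrow> bool) \<Rightarrow> (nat \<Rightarrow> 'v) \<Rightarrow> fm \<Rightarrow> bool" where
  "sat D E s p \<equiv> csat D E (\<lambda>_. {}) s p"

subsection \<open>The axioms\<close>

definition is_upair :: "('v \<Rightarrow> 'v \<Rightarrow> bool) \<Rightarrow> 'v \<Rightarrow> 'v \<Rightarrow> 'v \<Rightarrow> bool" where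
  "is_upair E a b p \<longleftrightarrow> (\<forall>z. E z p \<longleftrightarrow> z = a \<or> z = b)"

definition is_opair :: "('v \<Rightarrow> 'v \<Rightarrow> bool) \<Rightarrow> 'v \<Rightarrow> 'v \<Rightarrow> 'v \<Rightarrow> bool" where
  "is_opair E a b p \<longleftrightarrow> (\<exists>u v. is_upair E a a u \<and> is_upair E a b v \<and> is_upair E u v p)"

definition class_rel :: "('v \<Rightarrow> 'v \<Rightarrow> bool) \<Rightarrow> 'v set \<Rightarrow> 'v \<Rightarrow> 'v \<Rightarrow> bool" where
  "class_rel E F x y \<longleftrightarrow> (\<exists>p\<in>F. is_opair E x y p)"

text \<open>
  Extensionality, pairing, union, power set and infinity, relativized to \<open>D\<close>.
\<close>

definition basic_axioms :: "'v set \<Rightarrow> ('v \<Rightarrow> 'v \<Rightarrow> bool) \<Rightarrow> bool" where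
  "basic_axioms D E \<longleftrightarrow>
     (\<forall>x\<in>D. \<forall>y\<in>D. (\<forall>z\<in>D. E z x \<longleftrightarrow> E z y) \<longrightarrow> x = y) \<and>
     (\<forall>a\<in>D. \<forall>b\<in>D. \<exists>p\<in>D. \<forall>z\<in>D. E z p \<longleftrightarrow> z = a \<or> z = b) \<and>
     (\<forall>x\<in>D. \<exists>u\<in>D. \<forall>z\<in>D. E z u \<longleftrightarrow> (\<exists>y\<in>D. E y x \<and> E z y)) \<and>
     (\<forall>x\<in>D. \<exists>p\<in>D. \<forall>z\<in>D. E z p \<longleftrightarrow> (\<forall>w\<in>D. E w z \<longrightarrow> E w x)) \<and>
     (\<exists>w\<in>D. (\<exists>e\<in>D. E e w \<and> (\<forall>z\<in>D. \<not> E z e)) \<and>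
        (\<forall>x\<in>D. E x w \<longrightarrow> (\<exists>y\<in>D. E y w \<and> (\<forall>z\<in>D. E z y \<longleftrightarrow> E z x \<or> z = x))))"

definition ZF_model :: "'v set \<Rightarrow> ('v \<Rightarrow> 'v \<Rightarrow> bool) \<Rightarrow> bool" where
  "ZF_model D E \<longleftrightarrow>
     basic_axioms D E \<and>
     (\<forall>x\<in>D. (\<exists>y\<in>D. E y x) \<longrightarrow> (\<exists>y\<in>D. E y x \<and> (\<forall>z\<in>D. E z x \<longrightarrow> \<not> E z y))) \<and>
     (\<forall>p s. set_formula p \<longrightarrow> range s \<subseteq> D \<longrightarrow>
        (\<forall>a\<in>D. \<exists>b\<in>D. \<forall>x\<in>D. E x b \<longleftrightarrow> E x a \<and> sat D E (s(0 := x)) p)) \<and>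
     (\<forall>p s. set_formula p \<longrightarrow> range s \<subseteq> D \<longrightarrow>
        (\<forall>a\<in>D.
           (\<forall>x\<in>D. \<forall>y\<in>D. \<forall>y'\<in>D. E x a \<longrightarrow> sat D E (s(0 := x, 1 := y)) p \<longrightarrow>
              sat D E (s(0 := x, 1 := y')) p \<longrightarrow> y = y') \<longrightarrow>
           (\<exists>b\<in>D. \<forall>y\<in>D. E y b \<longleftrightarrow> (\<exists>x\<in>D. E x a \<and> sat D E (s(0 := x, 1 := y)) p))))"

locale NGBC =
  fixes E :: "'v \<Rightarrow> 'v \<Rightarrow> bool" and \<C> :: "'v set set"
  assumes basic: "basic_axioms UNIV E"
    and class_comprehension:
      "\<And>p P s n. range P \<subseteq> \<C> \<Longrightarrow> {x. csat UNIV E P (s(n := x)) p} \<in> \<C>"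
    and foundation:
      "\<And>X. X \<in> \<C> \<Longrightarrow> X \<noteq> {} \<Longrightarrow> \<exists>x\<in>X. \<forall>y\<in>X. \<not> E y x"
    and replacement:
      "\<And>F a. F \<in> \<C> \<Longrightarrow>
         (\<And>x y y'. class_rel E F x y \<Longrightarrow> class_rel E F x y' \<Longrightarrow> y = y') \<Longrightarrow>
         \<exists>b. \<forall>y. E y b \<longleftrightarrow> (\<exists>x. E x a \<and> class_rel E F x y)"
    and global_choice:
      "\<exists>F\<in>\<C>. \<forall>x. (\<exists>y. E y x) \<longrightarrow> (\<exists>!y. class_rel E F x y) \<and> (\<forall>y. class_rel E F x y \<longrightarrow> E y x)"

subsection \<open>Inner models and elementary embeddings\<close>

definition transitive_set :: "('v \<Rightarrow> 'v \<Rightarrow> bool) \<Rightarrow> 'v \<Rightarrow> bool" where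
  "transitive_set E t \<longleftrightarrow> (\<forall>x y. E x t \<longrightarrow> E y x \<longrightarrow> E y t)"

text \<open>
  Well-foundedness of the membership relation on an ordinal is supplied by the axiom of
  foundation.
\<close>

definition ordinal :: "('v \<Rightarrow> 'v \<Rightarrow> bool) \<Rightarrow> 'v \<Rightarrow> bool" where
  "ordinal E a \<longleftrightarrow>
     transitive_set E a \<and> (\<forall>x y. E x a \<longrightarrow> E y a \<longrightarrow> E x y \<or> x = y \<or> E y x)"

definition inner_model :: "('v \<Rightarrow> 'v \<Rightarrow> bool) \<Rightarrow> 'v set set \<Rightarrow> 'v set \<Rightarrow> bool" where
  "inner_model E \<C> M \<longleftrightarrow>
     M \<in> \<C> \<and>
     (\<forall>x\<in>M. \<forall>y. E y x \<longrightarrow> y \<in> M) \<and>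
     (\<nexists>a. M = {x. E x a}) \<and>
     {a. ordinal E a} \<subseteq> M \<and>
     ZF_model M E"

text \<open>
  The embedding is itself a class of the model.
\<close>

definition elementary_embedding ::
    "('v \<Rightarrow> 'v \<Rightarrow> bool) \<Rightarrow> 'v set set \<Rightarrow> ('v \<Rightarrow> 'v) \<Rightarrow> 'v set \<Rightarrow> bool" where
  "elementary_embedding E \<C> j M \<longleftrightarrow>
     {p. \<exists>x. is_opair E x (j x) p} \<in> \<C> \<and>
     range j \<subseteq> M \<and>
     (\<forall>p s. delta0 p \<longrightarrow> (sat UNIV E s p \<longleftrightarrow> sat M E (j \<circ> s) p)) \<and>
     (\<forall>y\<in>M. \<exists>x. E y (j x))"

subsection \<open>Definability\<close>

text \<open>
  The set \<open>x\<close> is definable in the universe from finitely many parameters in \<open>A\<close>. Variable \<open>0\<close>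
  stands for the defined set; the other free variables stand for the parameters.
\<close>

definition definable_from :: "('v \<Rightarrow> 'v \<Rightarrow> bool) \<Rightarrow> 'v set \<Rightarrow> 'v \<Rightarrow> bool" where
  "definable_from E A x \<longleftrightarrow>
     (\<exists>p s. set_formula p \<and> (\<forall>i \<in> fv p - {0}. s i \<in> A) \<and>
        (\<forall>y. sat UNIV E (s(0 := y)) p \<longleftrightarrow> y = x))"

definition OD :: "('v \<Rightarrow> 'v \<Rightarrow> bool) \<Rightarrow> 'v set \<Rightarrow> 'v set" where
  "OD E A = {x. definable_from E ({a. ordinal E a} \<union> A) x}"

text \<open>
  The transitive closure of \<open>{x}\<close> is formed inside the model, as the intersection of all transitive
  sets containing \<open>x\<close>; the closure of \<open>E\<close> in the metatheory is smaller if the model has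
  nonstandard natural numbers.
\<close>

definition tc_singleton :: "('v \<Rightarrow> 'v \<Rightarrow> bool) \<Rightarrow> 'v \<Rightarrow> 'v set" where
  "tc_singleton E x = {y. \<forall>t. transitive_set E t \<longrightarrow> E x t \<longrightarrow> E y t}"

definition HOD :: "('v \<Rightarrow> 'v \<Rightarrow> bool) \<Rightarrow> 'v set \<Rightarrow> 'v set" where
  "HOD E A = {x. tc_singleton E x \<subseteq> OD E A}"

end

theory Submission
  imports Defs
begin

text \<open>
  Given a set \<open>x\<close>, close it off to a transitive set \<open>D\<close> containing \<open>x\<close> that is closed under pairs and
  satisfies \<open>j(D) \<subseteq> D\<close>, by iterating \<open>\<omega>\<close> times. Let \<open>l\<close> be the Hartogs number of \<open>D\<close>. It is regular, and
  \<open>j(l) = l\<close> because the ordinals below \<open>j(l)\<close> inject into \<open>j(D) \<subseteq> D\<close>. An Ulam matrix yields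
  \<open>g : l \<rightarrow> D\<close> all of whose fibres are stationary on the points of cofinality \<open>\<omega>\<close>. As \<open>j\<close> is
  continuous at such points, Woodin's argument shows that \<open>v \<in> j(D)\<close> belongs to \<open>j''D\<close> iff the
  fibre of \<open>j(g)\<close> over \<open>v\<close> is stationary in \<open>l\<close>. Hence \<open>j''D\<close> is definable from \<open>j(D)\<close>, \<open>j(l) = l\<close> and
  \<open>j(g)\<close>, and \<open>x\<close> is the image of \<open>j(x)\<close> under its transitive collapse. The claims about \<open>HOD(M)\<close>
  follow by monotonicity in the parameters.

  Since the model may be ill-founded in the metatheory, every induction and every choice is made
  inside it and must be shown to be given by a class.
\<close>

section \<open>Formulas\<close>

text \<open>The inner model may be wrong about cofinality and stationarity, and only bounded
  formulas are transferred by \<open>j\<close>. Stationarity itself is therefore never transferred: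
  it is computed in the universe for the fibres of \<open>j(g)\<close>, and the two inclusions are
  proved by passing between closure points \<open>x\<close> and \<open>j x\<close>. Cofinality omega
  enters because there \<open>j x\<close> is the supremum of the images of a cofinal sequence. The
  closure properties of \<open>D\<close> do the cardinal arithmetic. Pairs make a union of at most
  \<open>|D|\<close> many sets of size at most \<open>|D|\<close> again of that size, whence
  \<open>l\<close> is regular; containing the natural numbers makes its cofinality uncountable. As
  \<open>l\<close> is a successor cardinal, an Ulam matrix takes the place of Solovay's splitting
  theorem. The final definition must mention neither \<open>j\<close> nor chosen sets. Definability
  is thus tracked for two families at once: all classes, for arguments inside the model, and the
  classes definable without parameters.\<close>

lemma csat_cong:
  "(\<And>i. i \<in> fv p \<Longrightarrow> s i = t i) \<Longrightarrow> csat D E P s p = csat D E P t p"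
proof (induction p arbitrary: s t)
  case (Ex n p)
  have "csat D E P (s(n := a)) p = csat D E P (t(n := a)) p" for a
    using Ex.prems by (intro Ex.IH) auto
  then show ?case by simp
next
  case (And p q)
  have "csat D E P s p = csat D E P t p" "csat D E P s q = csat D E P t q"
    by (auto intro!: And.IH And.prems)
  then show ?case by simp
next
  case (Neg p)
  have "csat D E P s p = csat D E P t p"
    by (auto intro!: Neg.IH Neg.prems)
  then show ?case by simp
qed auto

lemma csat_set_formula: "set_formula p \<Longrightarrow> csat D E P s p = csat D E Q s p"
  by (induction p arbitrary: s) auto

primrec rename :: "(nat \<Rightarrow> nat) \<Rightarrow> fm \<Rightarrow> fm" where
  "rename r (Mem m n) = Mem (r m) (r n)"
| "rename r (Eq m n) = Eq (r m) (r n)"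
| "rename r (InCls n k) = InCls (r n) k"
| "rename r (Neg p) = Neg (rename r p)"
| "rename r (And p q) = And (rename r p) (rename r q)"
| "rename r (Ex n p) = Ex (r n) (rename r p)"

text \<open>Bound variables are renamed along with free ones, so injectivity of \<open>r\<close>
  excludes capture: updating at \<open>r n\<close> and composing with \<open>r\<close> is updating
  at \<open>n\<close>.\<close>

lemma csat_rename: "inj r \<Longrightarrow> csat D E P s (rename r p) = csat D E P (s \<circ> r) p"
proof (induction p arbitrary: s)
  case (Ex n p)
  have "s(r n := a) \<circ> r = (s \<circ> r)(n := a)" for a
    using Ex.prems by (auto simp: fun_eq_iff inj_eq)
  then show ?case by (simp only: rename.simps csat.simps Ex.IH[OF Ex.prems])
qed auto

lemma fv_rename: "inj r \<Longrightarrow> fv (rename r p) = r ` fv p"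
  by (induction p) (auto simp: inj_eq image_Un image_set_diff)

lemma set_formula_rename [simp]: "set_formula (rename r p) = set_formula p"
  by (induction p) auto

text \<open>The formulas \<open>q k\<close> have at most \<open>0\<close> free; renaming by a transposition avoids capture.\<close>

primrec subst_cls :: "(nat \<Rightarrow> fm) \<Rightarrow> fm \<Rightarrow> fm" where
  "subst_cls q (Mem m n) = Mem m n"
| "subst_cls q (Eq m n) = Eq m n"
| "subst_cls q (InCls n k) = rename (id(0 := n, n := 0)) (q k)"
| "subst_cls q (Neg p) = Neg (subst_cls q p)"
| "subst_cls q (And p r) = And (subst_cls q p) (subst_cls q r)"
| "subst_cls q (Ex n p) = Ex n (subst_cls q p)"

lemma inj_swap0: "inj (id(0 := n, n := 0 :: nat))"
  by (auto simp: inj_on_def split: if_splits)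

lemma set_formula_subst_cls: "(\<And>k. set_formula (q k)) \<Longrightarrow> set_formula (subst_cls q p)"
  by (induction p) auto

lemma fv_subst_cls: "(\<And>k. fv (q k) \<subseteq> {0}) \<Longrightarrow> fv (subst_cls q p) \<subseteq> fv p"
proof (induction p)
  case (InCls n k)
  have "(id(0 := n, n := 0)) ` fv (q k) \<subseteq> (id(0 := n, n := 0)) ` {0}"
    using InCls by blast
  also have "\<dots> \<subseteq> {n}" by auto
  finally show ?case by (simp only: subst_cls.simps fv_rename[OF inj_swap0] fv.simps)
qed auto

text \<open>Swapping 0 and \<open>n\<close> makes \<open>q k\<close> speak about \<open>s n\<close>;
  as nothing else is free in \<open>q k\<close>, the rest of the assignment does not matter.\<close>

lemma csat_subst_cls:
  assumes "\<And>k. fv (q k) \<subseteq> {0}"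
  shows "csat D E P s (subst_cls q p) =
    csat D E (\<lambda>k. {x. csat D E P (\<lambda>_. x) (q k)}) s p"
proof (induction p arbitrary: s)
  case (InCls n k)
  have "csat D E P (s \<circ> id(0 := n, n := 0)) (q k) = csat D E P (\<lambda>_. s n) (q k)"
    using assms[of k] by (intro csat_cong) auto
  then show ?case by (simp add: csat_rename[OF inj_swap0])
qed auto

text \<open>The indices 100 to 102 are reserved for bound variables. All quantifiers are bounded (in
  \<open>OpairF\<close> the two components are sought among the members of \<open>p\<close>), which
  keeps the formulas Delta0 and thus transferable by \<open>j\<close>.\<close>

definition UpairF :: "nat \<Rightarrow> nat \<Rightarrow> nat \<Rightarrow> fm" where
  "UpairF a b u = And (Mem a u) (And (Mem b u)
     (Neg (Ex 102 (And (Mem 102 u) (And (Neg (Eq 102 a)) (Neg (Eq 102 b)))))))"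

definition OpairF :: "nat \<Rightarrow> nat \<Rightarrow> nat \<Rightarrow> fm" where
  "OpairF a b p = Ex 100 (And (Mem 100 p) (Ex 101 (And (Mem 101 p)
     (And (UpairF a a 100) (And (UpairF a b 101) (UpairF 100 101 p))))))"

abbreviation ImpF :: "fm \<Rightarrow> fm \<Rightarrow> fm" where
  "ImpF p q \<equiv> Neg (And p (Neg q))"

abbreviation OrF :: "fm \<Rightarrow> fm \<Rightarrow> fm" where
  "OrF p q \<equiv> Neg (And (Neg p) (Neg q))"

abbreviation BexF :: "nat \<Rightarrow> nat \<Rightarrow> fm \<Rightarrow> fm" where
  "BexF n m p \<equiv> Ex n (And (Mem n m) p)"

abbreviation BallF :: "nat \<Rightarrow> nat \<Rightarrow> fm \<Rightarrow> fm" where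
  "BallF n m p \<equiv> Neg (BexF n m (Neg p))"

lemma delta0_UpairF: "u < 100 \<or> u = 100 \<or> u = 101 \<Longrightarrow> delta0 (UpairF a b u)"
  unfolding UpairF_def by (intro delta0.intros) auto

lemma delta0_OpairF: "p < 100 \<Longrightarrow> delta0 (OpairF a b p)"
  unfolding OpairF_def by (intro delta0.intros delta0_UpairF) auto

lemma fv_OpairF: "\<lbrakk>a < 100; b < 100; p < 100\<rbrakk> \<Longrightarrow> fv (OpairF a b p) = {a, b, p}"
  by (auto simp: OpairF_def UpairF_def)

lemma set_formula_OpairF [simp]: "set_formula (OpairF a b p)"
  by (simp add: OpairF_def UpairF_def)

section \<open>Basic axioms, ordered pairs and projections inside the model\<close>

context NGBC
begin

notation E (infix "\<epsilon>" 50)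

lemma ext: "(\<And>z. z \<epsilon> x \<longleftrightarrow> z \<epsilon> y) \<Longrightarrow> x = y"
  using basic[unfolded basic_axioms_def ball_UNIV bex_UNIV, THEN conjunct1] by blast

lemma pairing_axiom: "\<exists>p. \<forall>z. z \<epsilon> p \<longleftrightarrow> z = a \<or> z = b"
  using basic[unfolded basic_axioms_def ball_UNIV bex_UNIV, THEN conjunct2, THEN conjunct1] by blast

lemma union_axiom: "\<exists>u. \<forall>z. z \<epsilon> u \<longleftrightarrow> (\<exists>y. y \<epsilon> x \<and> z \<epsilon> y)"
  using basic[unfolded basic_axioms_def ball_UNIV bex_UNIV, THEN conjunct2, THEN conjunct2, THEN conjunct1] by blast

lemma power_axiom: "\<exists>p. \<forall>z. z \<epsilon> p \<longleftrightarrow> (\<forall>w. w \<epsilon> z \<longrightarrow> w \<epsilon> x)"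
  using basic[unfolded basic_axioms_def ball_UNIV bex_UNIV, THEN conjunct2, THEN conjunct2, THEN conjunct2, THEN conjunct1] by blast

lemma infinity_axiom: "\<exists>w. (\<exists>e. e \<epsilon> w \<and> (\<forall>z. \<not> z \<epsilon> e)) \<and>
    (\<forall>x. x \<epsilon> w \<longrightarrow> (\<exists>y. y \<epsilon> w \<and> (\<forall>z. z \<epsilon> y \<longleftrightarrow> z \<epsilon> x \<or> z = x)))"
  using basic[unfolded basic_axioms_def ball_UNIV bex_UNIV, THEN conjunct2, THEN conjunct2, THEN conjunct2, THEN conjunct2] .

text \<open>The junk value is the empty set.\<close>

definition coll :: "('v \<Rightarrow> bool) \<Rightarrow> 'v" where
  "coll P = (if \<exists>x. \<forall>y. y \<epsilon> x \<longleftrightarrow> P y then THE x. \<forall>y. y \<epsilon> x \<longleftrightarrow> P y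
             else THE x. \<forall>y. \<not> y \<epsilon> x)"

lemma the_coll: "(\<And>y. y \<epsilon> x \<longleftrightarrow> P y) \<Longrightarrow> (THE x. \<forall>y. y \<epsilon> x \<longleftrightarrow> P y) = x"
  by (rule the_equality) (auto intro: ext)

lemma mem_coll: "\<exists>x. \<forall>y. y \<epsilon> x \<longleftrightarrow> P y \<Longrightarrow> y \<epsilon> coll P \<longleftrightarrow> P y"
  unfolding coll_def using the_coll[of _ P] by auto

definition upr :: "'v \<Rightarrow> 'v \<Rightarrow> 'v" where
  "upr a b = coll (\<lambda>z. z = a \<or> z = b)"

lemma mem_upr [simp]: "z \<epsilon> upr a b \<longleftrightarrow> z = a \<or> z = b"
  unfolding upr_def using pairing_axiom by (rule mem_coll)

lemma upr_eq_iff: "u = upr a b \<longleftrightarrow> (\<forall>z. z \<epsilon> u \<longleftrightarrow> z = a \<or> z = b)"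
  by (auto intro: ext)

definition pr :: "'v \<Rightarrow> 'v \<Rightarrow> 'v" where
  "pr a b = upr (upr a a) (upr a b)"

lemma upr_inject: "upr a b = upr c d \<longleftrightarrow> (a = c \<and> b = d) \<or> (a = d \<and> b = c)"
  by (auto simp: upr_eq_iff)

lemma pr_inject [simp]: "pr a b = pr c d \<longleftrightarrow> a = c \<and> b = d"
  by (auto simp: pr_def upr_inject)

lemma is_opair_iff: "is_opair E a b p \<longleftrightarrow> p = pr a b"
  by (simp only: is_opair_def is_upair_def pr_def upr_eq_iff[symmetric]) auto

lemma csat_UpairF [simp]: "\<lbrakk>a \<noteq> 102; b \<noteq> 102; u \<noteq> 102\<rbrakk> \<Longrightarrow>
    csat UNIV E P s (UpairF a b u) \<longleftrightarrow> s u = upr (s a) (s b)"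
  by (auto simp: UpairF_def upr_eq_iff)

lemma csat_OpairF [simp]: "\<lbrakk>a < 100; b < 100; p < 100\<rbrakk> \<Longrightarrow>
    csat UNIV E P s (OpairF a b p) \<longleftrightarrow> s p = pr (s a) (s b)"
  by (auto simp: OpairF_def pr_def)

definition p1 :: "'v \<Rightarrow> 'v" where
  "p1 p = (if \<exists>a b. p = pr a b then THE a. \<exists>b. p = pr a b else p)"

definition p2 :: "'v \<Rightarrow> 'v" where
  "p2 p = (if \<exists>a b. p = pr a b then THE b. \<exists>a. p = pr a b else p)"

lemma p1_pr [simp]: "p1 (pr a b) = a"
  unfolding p1_def by auto

lemma p2_pr [simp]: "p2 (pr a b) = b"
  unfolding p2_def by auto

lemma p1_no_pair: "\<nexists>a b. p = pr a b \<Longrightarrow> p1 p = p"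
  and p2_no_pair: "\<nexists>a b. p = pr a b \<Longrightarrow> p2 p = p"
  by (simp_all add: p1_def p2_def)

lemma eq_p1_iff: "a = p1 p \<longleftrightarrow> (\<exists>b. p = pr a b) \<or> (\<nexists>a b. p = pr a b) \<and> p = a"
  by (cases "\<exists>a b. p = pr a b") (auto simp: p1_no_pair)

lemma eq_p2_iff: "b = p2 p \<longleftrightarrow> (\<exists>a. p = pr a b) \<or> (\<nexists>a b. p = pr a b) \<and> p = b"
  by (cases "\<exists>a b. p = pr a b") (auto simp: p2_no_pair)

end

section \<open>Definability\<close>

text \<open>
  Definability without formulas: \<open>fam K\<close> says that the family \<open>K\<close> is closed under predicative
  comprehension without set parameters, \<open>cls K Q\<close> that the predicate \<open>Q\<close> is in \<open>K\<close>, and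
  \<open>cfn K f\<close> that the graph of \<open>f\<close> is. A context with several variables is coded as one variable by
  internal pairs, so that quantifiers are handled by the projections \<open>p1\<close>, \<open>p2\<close>.
\<close>

named_theorems cl

context NGBC
begin

definition fam :: "'v set set \<Rightarrow> bool" where
  "fam K \<longleftrightarrow> K \<noteq> {} \<and>
     (\<forall>p P. range P \<subseteq> K \<longrightarrow> fv p \<subseteq> {0} \<longrightarrow> {x. csat UNIV E P (\<lambda>_. x) p} \<in> K)"

definition cls :: "'v set set \<Rightarrow> ('v \<Rightarrow> bool) \<Rightarrow> bool" where
  "cls K Q \<longleftrightarrow> {x. Q x} \<in> K"

definition cfn :: "'v set set \<Rightarrow> ('v \<Rightarrow> 'v) \<Rightarrow> bool" where
  "cfn K f \<longleftrightarrow> cls K (\<lambda>z. \<exists>x. z = pr x (f x))"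

lemma cls_cong: "cls K P \<Longrightarrow> (\<And>x. P x \<longleftrightarrow> Q x) \<Longrightarrow> cls K Q"
  by (simp add: cls_def)

lemma cls_comprehension0:
  assumes "fam K" "fv p \<subseteq> {0}" "\<And>x. Q x \<longleftrightarrow> csat UNIV E (\<lambda>_. {}) (\<lambda>_. x) p" "set_formula p"
  shows "cls K Q"
proof -
  obtain X where "X \<in> K" using assms(1) by (auto simp: fam_def)
  moreover have "Q x \<longleftrightarrow> csat UNIV E (\<lambda>_. X) (\<lambda>_. x) p" for x
    using assms(3,4) csat_set_formula by blast
  ultimately show ?thesis using assms(1,2) by (auto simp: fam_def cls_def)
qed

lemma cls_comprehension2:
  assumes "fam K" "cls K A" "cls K B" "fv p \<subseteq> {0}"
    "\<And>x. Q x \<longleftrightarrow> csat UNIV E (\<lambda>i. if i = 0 then {x. A x} else {x. B x}) (\<lambda>_. x) p"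
  shows "cls K Q"
proof -
  have "range (\<lambda>i::nat. if i = 0 then {x. A x} else {x. B x}) \<subseteq> K"
    using assms(2,3) by (auto simp: cls_def)
  then show ?thesis using assms(1,4,5) by (auto simp: fam_def cls_def)
qed

lemma cls_not [cl]: "fam K \<Longrightarrow> cls K P \<Longrightarrow> cls K (\<lambda>x. \<not> P x)"
  by (rule cls_comprehension2[of K P P "Neg (InCls 0 0)"]) auto

lemma cls_and [cl]: "fam K \<Longrightarrow> cls K P \<Longrightarrow> cls K Q \<Longrightarrow> cls K (\<lambda>x. P x \<and> Q x)"
  by (rule cls_comprehension2[of K P Q "And (InCls 0 0) (InCls 0 1)"]) auto

lemma cls_or [cl]:
  assumes "fam K" "cls K P" "cls K Q" shows "cls K (\<lambda>x. P x \<or> Q x)"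
proof -
  have "cls K (\<lambda>x. \<not> (\<not> P x \<and> \<not> Q x))" by (intro cl assms)
  then show ?thesis by simp
qed

lemma cls_imp [cl]:
  assumes "fam K" "cls K P" "cls K Q" shows "cls K (\<lambda>x. P x \<longrightarrow> Q x)"
proof -
  have "cls K (\<lambda>x. \<not> P x \<or> Q x)" by (intro cl assms)
  then show ?thesis by (rule cls_cong) blast
qed

lemma cls_iff [cl]:
  assumes "fam K" "cls K P" "cls K Q" shows "cls K (\<lambda>x. P x \<longleftrightarrow> Q x)"
proof -
  have "cls K (\<lambda>x. (P x \<longrightarrow> Q x) \<and> (Q x \<longrightarrow> P x))" by (intro cl assms)
  then show ?thesis by (rule cls_cong) blast
qed

lemma cls_comp: "fam K \<Longrightarrow> cls K Q \<Longrightarrow> cfn K f \<Longrightarrow> cls K (\<lambda>c. Q (f c))"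
  unfolding cfn_def
  by (rule cls_comprehension2[of K "\<lambda>z. \<exists>x. z = pr x (f x)" Q
        "Ex 1 (Ex 2 (And (OpairF 0 1 2) (And (InCls 2 0) (InCls 1 1))))"])
     (auto simp: fv_OpairF)

lemma cls_ex [cl]: "fam K \<Longrightarrow> cls K (\<lambda>c. Q (p1 c) (p2 c)) \<Longrightarrow> cls K (\<lambda>c. \<exists>x. Q c x)"
  by (rule cls_comprehension2[of K "\<lambda>c. Q (p1 c) (p2 c)" "\<lambda>c. Q (p1 c) (p2 c)"
        "Ex 1 (Ex 2 (And (OpairF 0 1 2) (InCls 2 0)))"])
     (auto simp: fv_OpairF)

lemma cls_all [cl]:
  assumes "fam K" "cls K (\<lambda>c. Q (p1 c) (p2 c))" shows "cls K (\<lambda>c. \<forall>x. Q c x)"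
proof -
  have "cls K (\<lambda>c. \<not> (\<exists>x. \<not> Q c x))" by (intro cl assms)
  then show ?thesis by simp
qed

lemma cfn_id [cl]: "fam K \<Longrightarrow> cfn K (\<lambda>c. c)"
  unfolding cfn_def
  by (rule cls_comprehension0[of K "Ex 1 (OpairF 1 1 0)"]) (auto simp: fv_OpairF)

lemma cfn_pr [cl]: "fam K \<Longrightarrow> cfn K f \<Longrightarrow> cfn K g \<Longrightarrow> cfn K (\<lambda>c. pr (f c) (g c))"
  unfolding cfn_def
  by (rule cls_comprehension2[of K "\<lambda>z. \<exists>x. z = pr x (f x)" "\<lambda>z. \<exists>x. z = pr x (g x)"
        "Ex 1 (Ex 2 (Ex 3 (Ex 4 (Ex 5 (Ex 6 (And (OpairF 1 2 5) (And (InCls 5 0)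
           (And (OpairF 1 3 6) (And (InCls 6 1) (And (OpairF 2 3 4) (OpairF 1 4 0)))))))))))"])
     (auto simp: fv_OpairF)

lemma cls_mem [cl]:
  assumes "fam K" "cfn K f" "cfn K g" shows "cls K (\<lambda>c. f c \<epsilon> g c)"
proof -
  have "cls K (\<lambda>p. \<exists>a b. p = pr a b \<and> a \<epsilon> b)"
    by (rule cls_comprehension0[of K "Ex 1 (Ex 2 (And (OpairF 1 2 0) (Mem 1 2)))"])
       (auto simp: fv_OpairF assms)
  from cls_comp[OF assms(1) this cfn_pr[OF assms]] show ?thesis by simp
qed

lemma cls_eq [cl]:
  assumes "fam K" "cfn K f" "cfn K g" shows "cls K (\<lambda>c. f c = g c)"
proof -
  have "cls K (\<lambda>p. \<exists>a b. p = pr a b \<and> a = b)"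
    by (rule cls_comprehension0[of K "Ex 1 (Ex 2 (And (OpairF 1 2 0) (Eq 1 2)))"])
       (auto simp: fv_OpairF assms)
  from cls_comp[OF assms(1) this cfn_pr[OF assms]] show ?thesis by simp
qed

lemma cfn_comp:
  assumes "fam K" "cfn K g" "cfn K f" shows "cfn K (\<lambda>c. g (f c))"
  unfolding cfn_def
  by (rule cls_comprehension2[OF assms(1) assms(3)[unfolded cfn_def] assms(2)[unfolded cfn_def],
        of "Ex 1 (Ex 2 (Ex 3 (Ex 4 (Ex 5 (And (OpairF 1 2 4) (And (InCls 4 0)
           (And (OpairF 2 3 5) (And (InCls 5 1) (OpairF 1 3 0)))))))))"])
     (auto simp: fv_OpairF)

lemma cfn_p1: "fam K \<Longrightarrow> cfn K p1"
  unfolding cfn_def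
  by (rule cls_comprehension0[of K "Ex 1 (Ex 2 (And (OpairF 1 2 0) (OrF (Ex 3 (OpairF 2 3 1))
        (And (Neg (Ex 3 (Ex 4 (OpairF 3 4 1)))) (Eq 1 2)))))"])
     (auto simp: fv_OpairF eq_p1_iff p1_no_pair)

lemma cfn_p2: "fam K \<Longrightarrow> cfn K p2"
  unfolding cfn_def
  by (rule cls_comprehension0[of K "Ex 1 (Ex 2 (And (OpairF 1 2 0) (OrF (Ex 3 (OpairF 3 2 1))
        (And (Neg (Ex 3 (Ex 4 (OpairF 3 4 1)))) (Eq 1 2)))))"])
     (auto simp: fv_OpairF eq_p2_iff p2_no_pair)

lemmas [cl] = cfn_comp[OF _ cfn_p1] cfn_comp[OF _ cfn_p2]

text \<open>Reduces definability of a function to that of a relation describing its graph, which may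
  spell out default cases.\<close>

lemma cfnI:
  assumes "fam K" "\<And>x y. y = f x \<longleftrightarrow> R x y" "cls K (\<lambda>c. R (p1 c) (p2 c))"
  shows "cfn K f"
proof -
  have "cls K (\<lambda>z. z = pr (p1 z) (p2 z) \<and> R (p1 z) (p2 z))"
    by (intro cl assms)
  moreover have "(\<exists>x. z = pr x (f x)) \<longleftrightarrow> z = pr (p1 z) (p2 z) \<and> R (p1 z) (p2 z)" for z
    using assms(2) by (metis p1_pr p2_pr)
  ultimately show ?thesis by (simp add: cfn_def)
qed

lemma fam_C [cl]: "fam \<C>"
  unfolding fam_def
proof (intro conjI allI impI)
  show "\<C> \<noteq> {}" using global_choice by blast
  fix p and P :: "nat \<Rightarrow> 'v set"
  assume P: "range P \<subseteq> \<C>" and p: "fv p \<subseteq> {0}"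
  have "csat UNIV E P (undefined(0 := x)) p = csat UNIV E P (\<lambda>_. x) p" for x
    using p by (intro csat_cong) auto
  then show "{x. csat UNIV E P (\<lambda>_. x) p} \<in> \<C>"
    using class_comprehension[OF P, of undefined 0 p] by simp
qed

text \<open>The second family besides \<open>\<C>\<close>. No set parameters are allowed, so
  membership in it gives definitions from exactly the arguments that are listed.\<close>

definition C0 :: "'v set set" where
  "C0 = {X. \<exists>p. set_formula p \<and> fv p \<subseteq> {0} \<and> X = {x. sat UNIV E (\<lambda>_. x) p}}"

text \<open>Class variables are eliminated by substituting the formulas that define their
  values.\<close>

lemma csat_C0:
  assumes "range P \<subseteq> C0"
  obtains q where "set_formula q" "fv q \<subseteq> fv p" "\<And>s. sat UNIV E s q = csat UNIV E P s p"
proof -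
  have "\<exists>q. set_formula q \<and> fv q \<subseteq> {0} \<and> P k = {x. sat UNIV E (\<lambda>_. x) q}" for k
    using assms by (auto simp: C0_def subset_iff)
  then obtain q where q: "\<And>k. set_formula (q k)" "\<And>k. fv (q k) \<subseteq> {0}"
    "\<And>k. P k = {x. sat UNIV E (\<lambda>_. x) (q k)}" by metis
  have "P = (\<lambda>k. {x. sat UNIV E (\<lambda>_. x) (q k)})" using q(3) by auto
  then show thesis
    using that[of "subst_cls q p"] set_formula_subst_cls[of q] fv_subst_cls[of q, OF q(2)]
      csat_subst_cls[of q UNIV E "\<lambda>_. {}"] q by auto
qed

lemma fam_C0 [cl]: "fam C0"
  unfolding fam_def
proof (intro conjI allI impI)
  show "C0 \<noteq> {}"
    unfolding C0_def by (auto intro!: exI[of _ "Eq 0 0"])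
  fix p and P :: "nat \<Rightarrow> 'v set"
  assume P: "range P \<subseteq> C0" and p: "fv p \<subseteq> {0}"
  from csat_C0[OF P, of p] obtain q
    where "set_formula q" "fv q \<subseteq> fv p" "\<And>s. sat UNIV E s q = csat UNIV E P s p" by blast
  then show "{x. csat UNIV E P (\<lambda>_. x) p} \<in> C0"
    using p unfolding C0_def by (auto intro!: exI[of _ q])
qed

text \<open>This is where \<open>\<C>\<close> exceeds \<open>C0\<close>: its comprehension allows an
  arbitrary assignment, here with variable 1 holding the parameter \<open>a\<close>.\<close>

lemma cfn_const [cl]: "cfn \<C> (\<lambda>c. a)"
proof -
  obtain X where "X \<in> \<C>" using global_choice by blast
  then have "range (\<lambda>_::nat. X) \<subseteq> \<C>" by auto
  from class_comprehension[OF this, of "\<lambda>_. a" 2 "Ex 0 (OpairF 0 1 2)"]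
  show ?thesis by (simp add: cfn_def cls_def)
qed

lemma cls_const [cl]: "fam K \<Longrightarrow> cls K (\<lambda>c. b)"
  by (cases b) (auto intro: cls_comprehension0[of K "Eq 0 0"] cls_comprehension0[of K "Neg (Eq 0 0)"])

lemma cls_comp2:
  assumes "fam K" "cls K (\<lambda>p. R (p1 p) (p2 p))" "cfn K f" "cfn K g"
  shows "cls K (\<lambda>c. R (f c) (g c))"
  using cls_comp[OF assms(1,2) cfn_pr[OF assms(1,3,4)]] by simp

lemma cfn_comp2:
  assumes "fam K" "cfn K (\<lambda>p. F (p1 p) (p2 p))" "cfn K f" "cfn K g"
  shows "cfn K (\<lambda>c. F (f c) (g c))"
  using cfn_comp[OF assms(1,2) cfn_pr[OF assms(1,3,4)]] by simp

lemma cfn_coll [cl]: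
  assumes "fam K" "cls K (\<lambda>p. P (p1 p) (p2 p))"
  shows "cfn K (\<lambda>c. coll (P c))"
proof (rule cfnI[where R = "\<lambda>x y. (\<forall>z. z \<epsilon> y \<longleftrightarrow> P x z) \<or>
    \<not> (\<exists>w. \<forall>z. z \<epsilon> w \<longleftrightarrow> P x z) \<and> (\<forall>z. \<not> z \<epsilon> y)"])
  fix x y
  have e: "\<exists>y. \<forall>z. \<not> z \<epsilon> y"
    using infinity_axiom by blast
  show "y = coll (P x) \<longleftrightarrow> (\<forall>z. z \<epsilon> y \<longleftrightarrow> P x z) \<or>
      \<not> (\<exists>w. \<forall>z. z \<epsilon> w \<longleftrightarrow> P x z) \<and> (\<forall>z. \<not> z \<epsilon> y)"
  proof (cases "\<exists>w. \<forall>z. z \<epsilon> w \<longleftrightarrow> P x z")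
    case True
    then show ?thesis using mem_coll[OF True] by (auto intro: ext)
  next
    case False
    then have "coll (P x) = (THE x. \<forall>y. \<not> y \<epsilon> x)"
      unfolding coll_def by (rule if_not_P)
    also have "\<dots> = coll (\<lambda>_. False)" by (simp add: coll_def)
    finally have "coll (P x) = coll (\<lambda>_. False)" .
    moreover have "\<not> z \<epsilon> coll (\<lambda>_. False)" for z
      using mem_coll[of "\<lambda>_. False"] e by simp
    ultimately show ?thesis using False by (auto intro: ext)
  qed
qed (intro cl assms cls_comp2[OF assms])+

text \<open>Unlike \<open>THE\<close>, it has the empty set as value when there is no unique
  solution, so that descriptions stay definable in every \<open>fam\<close>.\<close>

definition the1 :: "('v \<Rightarrow> bool) \<Rightarrow> 'v" where
  "the1 P = (if \<exists>!y. P y then THE y. P y else coll (\<lambda>_. False))"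

lemma the1_equality: assumes "P a" "\<And>y. P y \<Longrightarrow> y = a" shows "the1 P = a"
proof -
  have "\<exists>!y. P y" using assms by (rule ex1I)
  moreover have "(THE y. P y) = a" using assms by (rule the_equality)
  ultimately show ?thesis by (simp add: the1_def)
qed

lemma cfn_the1 [cl]:
  assumes "fam K" "cls K (\<lambda>p. P (p1 p) (p2 p))"
  shows "cfn K (\<lambda>c. the1 (P c))"
proof (rule cfnI[where R = "\<lambda>x y. P x y \<and> (\<forall>z. P x z \<longrightarrow> z = y) \<or>
    \<not> (\<exists>w. P x w \<and> (\<forall>z. P x z \<longrightarrow> z = w)) \<and> y = coll (\<lambda>_. False)"])
  fix x y
  show "y = the1 (P x) \<longleftrightarrow> P x y \<and> (\<forall>z. P x z \<longrightarrow> z = y) \<or>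
      \<not> (\<exists>w. P x w \<and> (\<forall>z. P x z \<longrightarrow> z = w)) \<and> y = coll (\<lambda>_. False)"
  proof (cases "\<exists>w. P x w \<and> (\<forall>z. P x z \<longrightarrow> z = w)")
    case True
    then obtain w where w: "P x w" "\<And>z. P x z \<Longrightarrow> z = w" by blast
    then have "the1 (P x) = w" by (rule the1_equality)
    then show ?thesis using w by blast
  next
    case False
    then have "\<not> (\<exists>!y. P x y)" by blast
    then have "the1 (P x) = coll (\<lambda>_. False)" by (simp add: the1_def)
    then show ?thesis using False by auto
  qed
qed (intro cl assms cls_comp2[OF assms])+

lemma cfn_if [cl]:
  assumes "fam K" "cls K Q" "cfn K f" "cfn K g"
  shows "cfn K (\<lambda>c. if Q c then f c else g c)"
  by (rule cfnI[where R = "\<lambda>x y. Q x \<and> y = f x \<or> \<not> Q x \<and> y = g x"])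
     (auto intro!: cl assms cls_comp[OF assms(1,2)] cfn_comp[OF assms(1,3)] cfn_comp[OF assms(1,4)])

lemma cfn_upr [cl]:
  assumes "fam K" "cfn K f" "cfn K g"
  shows "cfn K (\<lambda>c. upr (f c) (g c))"
  unfolding upr_def by (intro cl assms(1) cfn_comp[OF assms(1,2)] cfn_comp[OF assms(1,3)])

section \<open>Set operations\<close>

definition emp :: 'v where "emp = coll (\<lambda>_. False)"

definition Uni :: "'v \<Rightarrow> 'v" where "Uni x = coll (\<lambda>z. \<exists>y. y \<epsilon> x \<and> z \<epsilon> y)"

definition Po :: "'v \<Rightarrow> 'v" where "Po x = coll (\<lambda>z. \<forall>w. w \<epsilon> z \<longrightarrow> w \<epsilon> x)"

definition bun :: "'v \<Rightarrow> 'v \<Rightarrow> 'v" where "bun x y = coll (\<lambda>z. z \<epsilon> x \<or> z \<epsilon> y)"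

definition suc :: "'v \<Rightarrow> 'v" where "suc x = bun x (upr x x)"

definition sep :: "'v \<Rightarrow> ('v \<Rightarrow> bool) \<Rightarrow> 'v" where "sep a P = coll (\<lambda>z. z \<epsilon> a \<and> P z)"

definition img :: "('v \<Rightarrow> 'v) \<Rightarrow> 'v \<Rightarrow> 'v" where "img f a = coll (\<lambda>z. \<exists>x. x \<epsilon> a \<and> z = f x)"

definition lam :: "('v \<Rightarrow> 'v) \<Rightarrow> 'v \<Rightarrow> 'v" where "lam f a = img (\<lambda>x. pr x (f x)) a"

definition app :: "'v \<Rightarrow> 'v \<Rightarrow> 'v" where "app f x = the1 (\<lambda>y. pr x y \<epsilon> f)"

definition cart :: "'v \<Rightarrow> 'v \<Rightarrow> 'v" where "cart a b = Uni (img (\<lambda>x. img (pr x) b) a)"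

lemma mem_emp [simp]: "\<not> x \<epsilon> emp"
  unfolding emp_def by (subst mem_coll) (use infinity_axiom in blast)+

lemma mem_Uni [simp]: "z \<epsilon> Uni x \<longleftrightarrow> (\<exists>y. y \<epsilon> x \<and> z \<epsilon> y)"
  unfolding Uni_def using union_axiom by (rule mem_coll)

lemma mem_Po [simp]: "z \<epsilon> Po x \<longleftrightarrow> (\<forall>w. w \<epsilon> z \<longrightarrow> w \<epsilon> x)"
  unfolding Po_def using power_axiom by (rule mem_coll)

lemma mem_bun [simp]: "z \<epsilon> bun x y \<longleftrightarrow> z \<epsilon> x \<or> z \<epsilon> y"
  unfolding bun_def
proof (rule mem_coll)
  show "\<exists>u. \<forall>z. z \<epsilon> u \<longleftrightarrow> z \<epsilon> x \<or> z \<epsilon> y" by (rule exI[of _ "Uni (upr x y)"]) auto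
qed

lemma mem_suc [simp]: "z \<epsilon> suc x \<longleftrightarrow> z \<epsilon> x \<or> z = x"
  by (simp add: suc_def)

lemma replacement':
  assumes "cls \<C> (\<lambda>z. R (p1 z) (p2 z))" "\<And>x y y'. R x y \<Longrightarrow> R x y' \<Longrightarrow> y = y'"
  shows "\<exists>b. \<forall>y. y \<epsilon> b \<longleftrightarrow> (\<exists>x. x \<epsilon> a \<and> R x y)"
proof -
  let ?F = "{z. \<exists>x y. z = pr x y \<and> R x y}"
  have "cls \<C> (\<lambda>z. \<exists>x y. z = pr x y \<and> R x y)"
    by (intro cl cls_comp2[OF fam_C assms(1)])
  then have F: "?F \<in> \<C>" by (simp add: cls_def)
  have rel: "class_rel E ?F x y \<longleftrightarrow> R x y" for x y
    by (auto simp: class_rel_def is_opair_iff)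
  show ?thesis using replacement[OF F, of a, unfolded rel] assms(2) by blast
qed

lemma mem_sep [simp]: assumes "cls \<C> P" shows "z \<epsilon> sep a P \<longleftrightarrow> z \<epsilon> a \<and> P z"
  unfolding sep_def
proof (rule mem_coll)
  have "cls \<C> (\<lambda>z. p1 z = p2 z \<and> P (p1 z))"
    by (intro cl cls_comp[OF fam_C assms])
  then have "\<exists>b. \<forall>y. y \<epsilon> b \<longleftrightarrow> (\<exists>x. x \<epsilon> a \<and> (x = y \<and> P x))"
    by (rule replacement') simp
  then show "\<exists>b. \<forall>z. z \<epsilon> b \<longleftrightarrow> z \<epsilon> a \<and> P z" by metis
qed

lemma mem_img [simp]: assumes "cfn \<C> f" shows "z \<epsilon> img f a \<longleftrightarrow> (\<exists>x. x \<epsilon> a \<and> z = f x)"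
  unfolding img_def
proof (rule mem_coll)
  have "cls \<C> (\<lambda>z. p2 z = f (p1 z))"
    by (intro cl cfn_comp[OF fam_C assms])
  then show "\<exists>b. \<forall>z. z \<epsilon> b \<longleftrightarrow> (\<exists>x. x \<epsilon> a \<and> z = f x)"
    by (rule replacement') simp
qed

lemma mem_lam [simp]: "cfn \<C> f \<Longrightarrow> z \<epsilon> lam f a \<longleftrightarrow> (\<exists>x. x \<epsilon> a \<and> z = pr x (f x))"
  unfolding lam_def by (rule mem_img) (intro cl)

lemma app_lam [simp]: "cfn \<C> f \<Longrightarrow> x \<epsilon> a \<Longrightarrow> app (lam f a) x = f x"
  unfolding app_def by (rule the1_equality) auto

lemma cfn_Uni [cl]:
  assumes "fam K" "cfn K f"
  shows "cfn K (\<lambda>c. Uni (f c))"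
  unfolding Uni_def by (intro cl assms(1) cfn_comp[OF assms(1,2)])

lemma cfn_emp [cl]: "fam K \<Longrightarrow> cfn K (\<lambda>c. emp)"
  unfolding emp_def by (intro cl)

lemma cfn_Po [cl]:
  assumes "fam K" "cfn K f"
  shows "cfn K (\<lambda>c. Po (f c))"
  unfolding Po_def by (intro cl assms(1) cfn_comp[OF assms(1,2)])

lemma cfn_bun [cl]:
  assumes "fam K" "cfn K f" "cfn K g"
  shows "cfn K (\<lambda>c. bun (f c) (g c))"
  unfolding bun_def by (intro cl assms(1) cfn_comp[OF assms(1,2)] cfn_comp[OF assms(1,3)])

lemma cfn_suc [cl]:
  assumes "fam K" "cfn K f"
  shows "cfn K (\<lambda>c. suc (f c))"
  unfolding suc_def by (intro cl assms)

lemma cfn_sep [cl]: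
  assumes "fam K" "cfn K f" "cls K (\<lambda>c. P (p1 c) (p2 c))"
  shows "cfn K (\<lambda>c. sep (f c) (P c))"
  unfolding sep_def by (intro cl assms(1) cfn_comp[OF assms(1,2)] assms(3))

lemma cfn_img [cl]:
  assumes "fam K" "cfn K (\<lambda>c. F (p1 c) (p2 c))" "cfn K a"
  shows "cfn K (\<lambda>c. img (F c) (a c))"
  unfolding img_def by (intro cl assms(1) cfn_comp2[OF assms(1,2)] cfn_comp[OF assms(1,3)])

lemma cfn_lam [cl]:
  assumes "fam K" "cfn K (\<lambda>c. F (p1 c) (p2 c))" "cfn K a"
  shows "cfn K (\<lambda>c. lam (F c) (a c))"
  unfolding lam_def by (intro cl assms)

lemma cfn_app [cl]:
  assumes "fam K" "cfn K f" "cfn K g"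
  shows "cfn K (\<lambda>c. app (f c) (g c))"
  unfolding app_def by (intro cl assms(1) cfn_comp[OF assms(1,2)] cfn_comp[OF assms(1,3)])

lemma mem_cart [simp]: "z \<epsilon> cart a b \<longleftrightarrow> (\<exists>x y. x \<epsilon> a \<and> y \<epsilon> b \<and> z = pr x y)"
proof -
  have 1: "cfn \<C> (\<lambda>x. img (pr x) b)" and 2: "cfn \<C> (pr x)" for x by (intro cl)+
  show ?thesis unfolding cart_def using 1 2 by auto
qed

lemma cfn_cart [cl]:
  assumes "fam K" "cfn K f" "cfn K g"
  shows "cfn K (\<lambda>c. cart (f c) (g c))"
  unfolding cart_def by (intro cl cfn_comp[OF assms(1,3)] assms)

text \<open>The metatheory chooses once, and what it chooses is a class. All later choices of sets
  go through \<open>ch\<close>, whose graph is a class.\<close>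

definition chF :: "'v set" where
  "chF = (SOME F. F \<in> \<C> \<and> (\<forall>x. (\<exists>y. y \<epsilon> x) \<longrightarrow>
     (\<exists>!y. class_rel E F x y) \<and> (\<forall>y. class_rel E F x y \<longrightarrow> y \<epsilon> x)))"

definition ch :: "'v \<Rightarrow> 'v" where "ch x = the1 (\<lambda>y. pr x y \<in> chF)"

lemma chF: "chF \<in> \<C>" "\<exists>y. y \<epsilon> x \<Longrightarrow> \<exists>!y. class_rel E chF x y"
  "\<exists>y. y \<epsilon> x \<Longrightarrow> class_rel E chF x y \<Longrightarrow> y \<epsilon> x"
proof -
  have "\<exists>F. F \<in> \<C> \<and> (\<forall>x. (\<exists>y. y \<epsilon> x) \<longrightarrow>
     (\<exists>!y. class_rel E F x y) \<and> (\<forall>y. class_rel E F x y \<longrightarrow> y \<epsilon> x))"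
    using global_choice by blast
  from someI_ex[OF this] show "chF \<in> \<C>" "\<exists>y. y \<epsilon> x \<Longrightarrow> \<exists>!y. class_rel E chF x y"
    "\<exists>y. y \<epsilon> x \<Longrightarrow> class_rel E chF x y \<Longrightarrow> y \<epsilon> x"
    unfolding chF_def by blast+
qed

lemma ch_mem: assumes "y \<epsilon> x" shows "ch x \<epsilon> x"
proof -
  have r: "class_rel E chF x y \<longleftrightarrow> pr x y \<in> chF" for y
    by (auto simp: class_rel_def is_opair_iff)
  have "\<exists>!y. pr x y \<in> chF" using chF(2)[of x] assms unfolding r by blast
  then have "pr x (ch x) \<in> chF" unfolding ch_def by (metis the1_equality)
  then show ?thesis using chF(3)[of x] assms unfolding r by blast
qed

lemma cfn_ch: "cfn \<C> ch"
proof -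
  have c: "cls \<C> (\<lambda>z. z \<in> chF)" using chF(1) by (simp add: cls_def)
  have "cfn \<C> (\<lambda>x. the1 (\<lambda>y. pr x y \<in> chF))"
    by (intro cl cls_comp[OF fam_C c])
  then show ?thesis by (simp add: ch_def[abs_def])
qed

lemmas [cl] = cfn_comp[OF fam_C cfn_ch]

lemma eps_induct:
  assumes "cls \<C> P" "\<And>x. (\<And>y. y \<epsilon> x \<Longrightarrow> P y) \<Longrightarrow> P x"
  shows "P a"
proof (rule ccontr)
  assume "\<not> P a"
  moreover have "{x. \<not> P x} \<in> \<C>" using cls_not[OF fam_C assms(1)] by (simp add: cls_def)
  ultimately show False using foundation[of "{x. \<not> P x}"] assms(2) by blast
qed

lemma mem_irrefl: "\<not> x \<epsilon> x"
proof -
  have "cls \<C> (\<lambda>z. z = x)" by (intro cl)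
  then show ?thesis using foundation[of "{z. z = x}"] by (auto simp: cls_def)
qed

lemma mem_asym: "x \<epsilon> y \<Longrightarrow> \<not> y \<epsilon> x"
proof -
  have "cls \<C> (\<lambda>z. z = x \<or> z = y)" by (intro cl)
  then show "x \<epsilon> y \<Longrightarrow> \<not> y \<epsilon> x"
    using foundation[of "{z. z = x \<or> z = y}"] by (auto simp: cls_def)
qed

section \<open>Ordinals and recursion\<close>

abbreviation "Ord \<equiv> ordinal E"

lemma cls_transitive_set [cl]:
  assumes "fam K" "cfn K f" shows "cls K (\<lambda>c. transitive_set E (f c))"
  unfolding transitive_set_def by (intro cl assms(1) cfn_comp[OF assms])

lemma cls_Ord [cl]:
  assumes "fam K" "cfn K f" shows "cls K (\<lambda>c. Ord (f c))"
  unfolding ordinal_def by (intro cl assms(1) cfn_comp[OF assms])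

lemma least_elt:
  assumes "cls \<C> P" "P a" shows "\<exists>x. P x \<and> (\<forall>y. y \<epsilon> x \<longrightarrow> \<not> P y)"
  using foundation[of "{x. P x}"] assms by (auto simp: cls_def)

lemma mem_no_3cycle: "x \<epsilon> y \<Longrightarrow> y \<epsilon> z \<Longrightarrow> \<not> z \<epsilon> x"
proof -
  have "cls \<C> (\<lambda>w. w = x \<or> w = y \<or> w = z)" by (intro cl)
  from least_elt[OF this, of x] show "x \<epsilon> y \<Longrightarrow> y \<epsilon> z \<Longrightarrow> \<not> z \<epsilon> x" by auto
qed

lemma Ord_trans: "Ord a \<Longrightarrow> x \<epsilon> a \<Longrightarrow> y \<epsilon> x \<Longrightarrow> y \<epsilon> a"
  by (auto simp: ordinal_def transitive_set_def)

lemma Ord_mem: assumes a: "Ord a" and x: "x \<epsilon> a" shows "Ord x"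
  unfolding ordinal_def transitive_set_def
proof (intro conjI allI impI)
  have lin: "y \<epsilon> a \<Longrightarrow> z \<epsilon> a \<Longrightarrow> y \<epsilon> z \<or> y = z \<or> z \<epsilon> y" for y z
    using a by (auto simp: ordinal_def)
  {
    fix y z assume yz: "y \<epsilon> x" "z \<epsilon> y"
    then have "z \<epsilon> a" using Ord_trans[OF a] x by blast
    then consider "z \<epsilon> x" | "z = x" | "x \<epsilon> z" using lin x by blast
    then show "z \<epsilon> x" using yz mem_asym mem_no_3cycle by cases blast+
  next
    fix y z assume "y \<epsilon> x" "z \<epsilon> x"
    then show "y \<epsilon> z \<or> y = z \<or> z \<epsilon> y" using Ord_trans[OF a x] lin by blast
  }
qed

lemma Ord_subset:
  assumes a: "Ord a" and b: "Ord b" and ab: "\<And>z. z \<epsilon> a \<Longrightarrow> z \<epsilon> b"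
  shows "a = b \<or> a \<epsilon> b"
proof (cases "\<exists>x. x \<epsilon> b \<and> \<not> x \<epsilon> a")
  case True
  have "cls \<C> (\<lambda>x. x \<epsilon> b \<and> \<not> x \<epsilon> a)" by (intro cl)
  from least_elt[OF this] True obtain x where
    x: "x \<epsilon> b" "\<not> x \<epsilon> a" "\<And>y. y \<epsilon> x \<Longrightarrow> \<not> (y \<epsilon> b \<and> \<not> y \<epsilon> a)" by metis
  have "a = x"
  proof (rule ext)
    fix z
    show "z \<epsilon> a \<longleftrightarrow> z \<epsilon> x"
    proof
      assume z: "z \<epsilon> a"
      then have "z \<epsilon> x \<or> z = x \<or> x \<epsilon> z" using ab b x(1) by (auto simp: ordinal_def)
      then show "z \<epsilon> x" using z x(2) Ord_trans[OF a] by blast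
    next
      assume "z \<epsilon> x"
      then show "z \<epsilon> a" using x(3) Ord_trans[OF b x(1)] by blast
    qed
  qed
  then show ?thesis using x by simp
next
  case False
  then show ?thesis using ab by (blast intro: ext)
qed

text \<open>The intersection \<open>c\<close> is an ordinal; if it differed from both
  \<open>a\<close> and \<open>b\<close>, it would belong to both and hence to itself.\<close>

lemma Ord_linear: assumes a: "Ord a" and b: "Ord b" shows "a \<epsilon> b \<or> a = b \<or> b \<epsilon> a"
proof -
  define c where "c = sep a (\<lambda>z. z \<epsilon> b)"
  have "cls \<C> (\<lambda>z. z \<epsilon> b)" by (intro cl)
  then have c: "z \<epsilon> c \<longleftrightarrow> z \<epsilon> a \<and> z \<epsilon> b" for z by (simp add: c_def)
  have "Ord c"
    using a b unfolding ordinal_def transitive_set_def c by blast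
  then have "c = a \<or> c \<epsilon> a" "c = b \<or> c \<epsilon> b"
    using Ord_subset a b c by blast+
  then show ?thesis using c mem_irrefl by metis
qed

lemma Ord_not_mem: "Ord a \<Longrightarrow> Ord b \<Longrightarrow> \<not> a \<epsilon> b \<Longrightarrow> z \<epsilon> b \<Longrightarrow> z \<epsilon> a"
  using Ord_linear[of a b] Ord_trans by blast

lemma Ord_emp: "Ord emp"
  by (simp add: ordinal_def transitive_set_def)

lemma Ord_suc: "Ord a \<Longrightarrow> Ord (suc a)"
  unfolding ordinal_def transitive_set_def mem_suc by blast

lemma Ord_Uni: assumes "\<And>x. x \<epsilon> w \<Longrightarrow> Ord x" shows "Ord (Uni w)"
  unfolding ordinal_def transitive_set_def
proof (intro conjI allI impI)
  show "y \<epsilon> Uni w" if "x \<epsilon> Uni w" "y \<epsilon> x" for x y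
    using that Ord_trans assms by auto
  show "x \<epsilon> y \<or> x = y \<or> y \<epsilon> x" if "x \<epsilon> Uni w" "y \<epsilon> Uni w" for x y
  proof -
    have "Ord x" "Ord y" using that assms Ord_mem by auto
    then show ?thesis by (rule Ord_linear)
  qed
qed

text \<open>The Burali-Forti argument: otherwise the set of all ordinals would be an
  ordinal.\<close>

lemma Ord_unbounded: "\<exists>x. Ord x \<and> \<not> x \<epsilon> b"
proof (rule ccontr)
  assume n: "\<nexists>x. Ord x \<and> \<not> x \<epsilon> b"
  have "cls \<C> Ord" by (intro cl)
  then have c: "x \<epsilon> sep b Ord \<longleftrightarrow> Ord x" for x using n by auto
  then have "Ord (sep b Ord)"
    using Ord_linear Ord_mem unfolding ordinal_def[of E "sep b Ord"] transitive_set_def by blast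
  then show False using c mem_irrefl by blast
qed

definition lst :: "('v \<Rightarrow> bool) \<Rightarrow> 'v" where
  "lst P = the1 (\<lambda>x. Ord x \<and> P x \<and> (\<forall>y. y \<epsilon> x \<longrightarrow> \<not> P y))"

lemma cfn_lst [cl]:
  assumes "fam K" "cls K (\<lambda>p. P (p1 p) (p2 p))" shows "cfn K (\<lambda>c. lst (P c))"
  unfolding lst_def by (intro cl assms(1) cls_comp2[OF assms])

lemma lst:
  assumes P: "cls \<C> P" and a: "Ord a" "P a"
  shows "Ord (lst P)" "P (lst P)" "\<And>y. y \<epsilon> lst P \<Longrightarrow> \<not> P y"
proof -
  have "cls \<C> (\<lambda>x. Ord x \<and> P x)" by (intro cl P)
  from least_elt[OF this, of a] a obtain x where
    x: "Ord x" "P x" "\<And>y. y \<epsilon> x \<Longrightarrow> \<not> P y" using Ord_mem by blast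
  have "lst P = x"
    unfolding lst_def using x Ord_linear by (intro the1_equality) blast+
  then show "Ord (lst P)" "P (lst P)" "\<And>y. y \<epsilon> lst P \<Longrightarrow> \<not> P y" using x by auto
qed

section \<open>Recursion along the ordinals\<close>

lemma img_cong: "(\<And>x. x \<epsilon> a \<Longrightarrow> f x = g x) \<Longrightarrow> img f a = img g a"
  unfolding img_def by (metis (full_types))

text \<open>An attempt at the recursion on a transitive domain. The step function receives the set
  of earlier values, not the function itself.\<close>

definition approx :: "('v \<Rightarrow> 'v \<Rightarrow> 'v) \<Rightarrow> 'v \<Rightarrow> 'v \<Rightarrow> bool" where
  "approx G d f \<longleftrightarrow> transitive_set E d \<and> (\<forall>y. y \<epsilon> d \<longrightarrow> app f y = G y (img (app f) y))"

definition recur :: "('v \<Rightarrow> 'v \<Rightarrow> 'v) \<Rightarrow> 'v \<Rightarrow> 'v" where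
  "recur G x = the1 (\<lambda>v. \<exists>d f. approx G d f \<and> x \<epsilon> d \<and> v = app f x)"

context
  fixes G :: "'v \<Rightarrow> 'v \<Rightarrow> 'v"
  assumes G: "cfn \<C> (\<lambda>p. G (p1 p) (p2 p))"
begin

lemma cls_approx:
  assumes "cfn \<C> d" "cfn \<C> f"
  shows "cls \<C> (\<lambda>c. approx G (d c) (f c))"
  unfolding approx_def
  by (intro cl cfn_comp[OF fam_C assms(1)] cfn_comp[OF fam_C assms(2)] cfn_comp2[OF fam_C G])

lemma cfn_recur: "cfn \<C> (recur G)"
  unfolding recur_def by (intro cl cls_approx)

lemma approx_agree:
  assumes f: "approx G d f" and f': "approx G d' f'"
  shows "x \<epsilon> d \<Longrightarrow> x \<epsilon> d' \<Longrightarrow> app f x = app f' x"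
proof -
  have "x \<epsilon> d \<longrightarrow> x \<epsilon> d' \<longrightarrow> app f x = app f' x"
  proof (rule eps_induct[of _ x])
    show "cls \<C> (\<lambda>x. x \<epsilon> d \<longrightarrow> x \<epsilon> d' \<longrightarrow> app f x = app f' x)" by (intro cl)
    fix x assume IH: "\<And>y. y \<epsilon> x \<Longrightarrow> y \<epsilon> d \<longrightarrow> y \<epsilon> d' \<longrightarrow> app f y = app f' y"
    show "x \<epsilon> d \<longrightarrow> x \<epsilon> d' \<longrightarrow> app f x = app f' x"
    proof (intro impI)
      assume x: "x \<epsilon> d" "x \<epsilon> d'"
      have "img (app f) x = img (app f') x"
        using IH x f f' by (intro img_cong) (auto simp: approx_def transitive_set_def)
      then show "app f x = app f' x" using f f' x by (simp add: approx_def)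
    qed
  qed
  then show "x \<epsilon> d \<Longrightarrow> x \<epsilon> d' \<Longrightarrow> app f x = app f' x" by blast
qed

lemma recur_app: "approx G d f \<Longrightarrow> x \<epsilon> d \<Longrightarrow> recur G x = app f x"
  unfolding recur_def using approx_agree by (intro the1_equality) blast+

lemma recur_approx: assumes "approx G d f" "x \<epsilon> d" shows "recur G x = G x (img (recur G) x)"
proof -
  have "img (app f) x = img (recur G) x"
    using assms recur_app by (intro img_cong) (auto simp: approx_def transitive_set_def)
  then show ?thesis using recur_app[OF assms] assms by (simp add: approx_def)
qed

lemma approx_exists: "Ord x \<longrightarrow> (\<exists>d f. approx G d f \<and> x \<epsilon> d)"
proof (rule eps_induct[of _ x])
  show "cls \<C> (\<lambda>x. Ord x \<longrightarrow> (\<exists>d f. approx G d f \<and> x \<epsilon> d))" by (intro cl cls_approx)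
  fix x assume IH: "\<And>y. y \<epsilon> x \<Longrightarrow> Ord y \<longrightarrow> (\<exists>d f. approx G d f \<and> y \<epsilon> d)"
  show "Ord x \<longrightarrow> (\<exists>d f. approx G d f \<and> x \<epsilon> d)"
  proof
    assume x: "Ord x"
    \<comment> \<open>By the induction hypothesis \<open>recur G\<close> is already correct below
      \<open>x\<close>; only the value at \<open>x\<close> has to be supplied.\<close>
    define h where "h z = (if z = x then G x (img (recur G) x) else recur G z)" for z
    have h: "cfn \<C> h"
      unfolding h_def
      by (intro cl cfn_comp[OF fam_C cfn_recur] cfn_comp2[OF fam_C G])
    have "approx G (suc x) (lam h (suc x))"
      unfolding approx_def
    proof (intro conjI allI impI)
      show "transitive_set E (suc x)" using Ord_suc[OF x] by (simp add: ordinal_def)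
      fix y assume y: "y \<epsilon> suc x"
      have "app (lam h (suc x)) z = recur G z" if "z \<epsilon> y" for z
      proof -
        have "z \<epsilon> x" using that y Ord_trans[OF x] by auto
        then show ?thesis using h mem_irrefl by (auto simp: h_def)
      qed
      then have "img (app (lam h (suc x))) y = img (recur G) y" by (rule img_cong)
      moreover have "h y = G y (img (recur G) y)"
        using y IH Ord_mem[OF x] recur_approx mem_irrefl unfolding h_def mem_suc by metis
      ultimately show "app (lam h (suc x)) y = G y (img (app (lam h (suc x))) y)"
        using h y by (simp del: mem_suc)
    qed
    moreover have "x \<epsilon> suc x" by simp
    ultimately show "\<exists>d f. approx G d f \<and> x \<epsilon> d" by blast
  qed
qed

lemma recur: "Ord x \<Longrightarrow> recur G x = G x (img (recur G) x)"
  using approx_exists recur_approx by blast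

end

section \<open>The natural numbers of the model\<close>

definition omega :: 'v where
  "omega = coll (\<lambda>n. \<forall>w. emp \<epsilon> w \<and> (\<forall>x. x \<epsilon> w \<longrightarrow> suc x \<epsilon> w) \<longrightarrow> n \<epsilon> w)"

lemma mem_omega: "n \<epsilon> omega \<longleftrightarrow> (\<forall>w. emp \<epsilon> w \<and> (\<forall>x. x \<epsilon> w \<longrightarrow> suc x \<epsilon> w) \<longrightarrow> n \<epsilon> w)"
  (is "_ \<longleftrightarrow> ?P n")
  unfolding omega_def
proof (rule mem_coll)
  obtain w e where e: "e \<epsilon> w" "\<forall>z. \<not> z \<epsilon> e"
    and s: "\<forall>x. x \<epsilon> w \<longrightarrow> (\<exists>y. y \<epsilon> w \<and> (\<forall>z. z \<epsilon> y \<longleftrightarrow> z \<epsilon> x \<or> z = x))"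
    using infinity_axiom by blast
  have "e = emp" using e by (intro ext) auto
  moreover have "suc x \<epsilon> w" if x: "x \<epsilon> w" for x
  proof -
    obtain y where y: "y \<epsilon> w" "\<forall>z. z \<epsilon> y \<longleftrightarrow> z \<epsilon> x \<or> z = x" using s x by blast
    then have "y = suc x" by (intro ext) simp
    then show ?thesis using y by simp
  qed
  ultimately have w: "emp \<epsilon> w \<and> (\<forall>x. x \<epsilon> w \<longrightarrow> suc x \<epsilon> w)" using e by blast
  have "cls \<C> ?P" by (intro cl)
  then have "y \<epsilon> sep w ?P \<longleftrightarrow> ?P y" for y using w by auto
  then show "\<exists>x. \<forall>y. y \<epsilon> x \<longleftrightarrow> ?P y" by blast
qed

lemma cfn_omega [cl]: "fam K \<Longrightarrow> cfn K (\<lambda>c. omega)"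
  unfolding omega_def by (intro cl)

lemma emp_omega: "emp \<epsilon> omega"
  by (simp add: mem_omega)

lemma suc_omega: "n \<epsilon> omega \<Longrightarrow> suc n \<epsilon> omega"
  unfolding mem_omega by blast

text \<open>\<open>sep omega P\<close> is inductive, so it contains \<open>omega\<close> by
  minimality. The argument is internal and covers nonstandard \<open>n\<close>.\<close>

lemma omega_induct:
  assumes "cls \<C> P" "n \<epsilon> omega" "P emp" "\<And>n. n \<epsilon> omega \<Longrightarrow> P n \<Longrightarrow> P (suc n)"
  shows "P n"
proof -
  have "emp \<epsilon> sep omega P \<and> (\<forall>x. x \<epsilon> sep omega P \<longrightarrow> suc x \<epsilon> sep omega P)"
    using assms emp_omega suc_omega by simp
  then have "n \<epsilon> sep omega P" using assms(2) mem_omega by blast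
  then show ?thesis using assms(1) by simp
qed

lemma Ord_omega_mem: assumes n: "n \<epsilon> omega" shows "Ord n"
  by (rule omega_induct[OF _ n]) (auto intro!: cl Ord_emp Ord_suc)

lemma omega_trans: assumes n: "n \<epsilon> omega" and m: "m \<epsilon> n" shows "m \<epsilon> omega"
proof -
  have "\<forall>m. m \<epsilon> n \<longrightarrow> m \<epsilon> omega"
    by (rule omega_induct[OF _ n]) (auto intro!: cl)
  then show ?thesis using m by blast
qed

lemma omega_cases: assumes n: "n \<epsilon> omega" shows "n = emp \<or> (\<exists>m. m \<epsilon> omega \<and> n = suc m)"
  by (rule omega_induct[OF _ n]) (auto intro!: cl)

end

section \<open>The embedding\<close>

locale embedded = NGBC +
  fixes M :: "'a set" and j :: "'a \<Rightarrow> 'a"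
  assumes inner: "inner_model E \<C> M" and emb: "elementary_embedding E \<C> j M"
begin

text \<open>Absoluteness of bounded formulas: by transitivity of \<open>M\<close>, members of an
  element of \<open>M\<close> are the same in \<open>M\<close> and in the universe.\<close>

lemma sat_delta0_M: "delta0 p \<Longrightarrow> range s \<subseteq> M \<Longrightarrow> sat M E s p = sat UNIV E s p"
proof (induction arbitrary: s rule: delta0.induct)
  case (5 n m p)
  have m: "s m \<in> M" using 5 by auto
  have "sat M E (s(n := a)) p = sat UNIV E (s(n := a)) p" if "a \<epsilon> s m" for a
  proof (rule "5.IH")
    have "a \<in> M" using inner m that by (auto simp: inner_model_def)
    then show "range (s(n := a)) \<subseteq> M" using 5 by auto
  qed
  moreover have "a \<in> M" if "a \<epsilon> s m" for a
    using inner m that by (auto simp: inner_model_def)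
  ultimately show ?case using 5 by auto
qed auto

text \<open>Combining elementarity with absoluteness makes \<open>j\<close> a Delta0-elementary map
  of the universe into itself; from here on \<open>M\<close> can be ignored.\<close>

lemma j_delta0: assumes "delta0 p" shows "sat UNIV E s p \<longleftrightarrow> sat UNIV E (j \<circ> s) p"
proof -
  have "range (j \<circ> s) \<subseteq> M" using emb by (auto simp: elementary_embedding_def)
  then show ?thesis
    using emb assms sat_delta0_M[OF assms] by (auto simp: elementary_embedding_def)
qed

lemma cfn_j: "cfn \<C> j"
  using emb by (simp add: elementary_embedding_def cfn_def cls_def is_opair_iff)

lemmas [cl] = cfn_comp[OF fam_C cfn_j]

lemma j_mem [simp]: "j x \<epsilon> j y \<longleftrightarrow> x \<epsilon> y"
  using j_delta0[of "Mem 0 1" "\<lambda>i. if i = 0 then x else y"] by (auto intro: delta0.intros)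

lemma j_upr: "j (upr a b) = upr (j a) (j b)"
proof -
  have "delta0 (UpairF 0 1 2)" by (intro delta0_UpairF) simp
  from j_delta0[OF this, of "undefined(0 := a, 1 := b, 2 := upr a b)"] show ?thesis by simp
qed

lemma j_pr: "j (pr a b) = pr (j a) (j b)"
  by (simp add: pr_def j_upr)

lemma j_subset:
  assumes "\<And>z. z \<epsilon> x \<Longrightarrow> z \<epsilon> y" "w \<epsilon> j x"
  shows "w \<epsilon> j y"
proof -
  have "delta0 (BallF 2 0 (Mem 2 1))" by (intro delta0.intros) simp
  from j_delta0[OF this, of "undefined(0 := x, 1 := y)"] show ?thesis using assms by auto
qed

lemma j_emp: "j emp = emp"
proof -
  have "delta0 (BallF 1 0 (Neg (Eq 1 1)))" by (intro delta0.intros) simp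
  from j_delta0[OF this, of "undefined(0 := emp)"] have "\<not> z \<epsilon> j emp" for z by auto
  then show ?thesis by (intro ext) simp
qed

lemma j_suc: "j (suc x) = suc (j x)"
proof -
  have "delta0 (And (Mem 0 1) (And (BallF 2 0 (Mem 2 1)) (BallF 2 1 (OrF (Mem 2 0) (Eq 2 0)))))"
    by (intro delta0.intros) simp_all
  from j_delta0[OF this, of "undefined(0 := x, 1 := suc x)"] show ?thesis
    by (intro ext) auto
qed

lemma j_Ord: assumes "Ord x" shows "Ord (j x)"
proof -
  have "delta0 (And (BallF 1 0 (BallF 2 1 (Mem 2 0)))
      (BallF 1 0 (BallF 2 0 (OrF (Mem 1 2) (OrF (Eq 1 2) (Mem 2 1))))))"
    by (intro delta0.intros) simp_all
  from j_delta0[OF this, of "undefined(0 := x)"] show ?thesis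
    using assms unfolding ordinal_def transitive_set_def by auto
qed

text \<open>If \<open>y\<close> is minimal with \<open>j y\<close> in \<open>y\<close>, applying
  \<open>j\<close> shows the same for its member \<open>j y\<close>, against minimality.\<close>

lemma j_not_below: assumes "Ord x" shows "\<not> j x \<epsilon> x"
proof
  assume x: "j x \<epsilon> x"
  have "cls \<C> (\<lambda>x. j x \<epsilon> x)" by (intro cl)
  from least_elt[OF this, of x] x obtain y where y: "j y \<epsilon> y" "\<And>z. z \<epsilon> y \<Longrightarrow> \<not> j z \<epsilon> z"
    by blast
  then show False using j_mem[of "j y" y] by blast
qed

lemma j_omega_mem: assumes n: "n \<epsilon> omega" shows "j n = n"
  by (rule omega_induct[OF _ n]) (auto intro!: cl simp: j_emp j_suc)

lemma j_omega: "j omega = omega"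
proof (rule ext)
  \<comment> \<open>The bounded formula says that each member of \<open>omega\<close> is empty or
    the successor of a member. Transferred to \<open>j omega\<close>, it allows an induction on
    membership that never leaves \<open>omega\<close>.\<close>
  have 1: "delta0 (BallF 1 0 (OrF (BallF 2 1 (Neg (Eq 2 2)))
      (BexF 2 0 (And (Mem 2 1) (And (BallF 3 2 (Mem 3 1))
        (BallF 3 1 (OrF (Mem 3 2) (Eq 3 2))))))))"
    by (intro delta0.intros) simp_all
  have "\<forall>n. n \<epsilon> omega \<longrightarrow> (\<forall>z. \<not> z \<epsilon> n) \<or>
      (\<exists>m. m \<epsilon> omega \<and> m \<epsilon> n \<and> (\<forall>z. z \<epsilon> m \<longrightarrow> z \<epsilon> n) \<and> (\<forall>z. z \<epsilon> n \<longrightarrow> z \<epsilon> m \<or> z = m))"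
    using omega_cases by (metis mem_emp mem_suc)
  then have jc: "\<forall>n. n \<epsilon> j omega \<longrightarrow> (\<forall>z. \<not> z \<epsilon> n) \<or>
      (\<exists>m. m \<epsilon> j omega \<and> m \<epsilon> n \<and> (\<forall>z. z \<epsilon> m \<longrightarrow> z \<epsilon> n) \<and> (\<forall>z. z \<epsilon> n \<longrightarrow> z \<epsilon> m \<or> z = m))"
    using j_delta0[OF 1, of "undefined(0 := omega)"] by simp
  fix n
  have "n \<epsilon> j omega \<longrightarrow> n \<epsilon> omega"
  proof (rule eps_induct[of _ n])
    show "cls \<C> (\<lambda>n. n \<epsilon> j omega \<longrightarrow> n \<epsilon> omega)" by (intro cl)
    fix n assume IH: "\<And>y. y \<epsilon> n \<Longrightarrow> y \<epsilon> j omega \<longrightarrow> y \<epsilon> omega"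
    show "n \<epsilon> j omega \<longrightarrow> n \<epsilon> omega"
    proof
      assume "n \<epsilon> j omega"
      then consider "\<forall>z. \<not> z \<epsilon> n" | m where "m \<epsilon> j omega" "m \<epsilon> n"
          "\<And>z. z \<epsilon> m \<Longrightarrow> z \<epsilon> n" "\<And>z. z \<epsilon> n \<Longrightarrow> z \<epsilon> m \<or> z = m"
        using jc by blast
      then show "n \<epsilon> omega"
      proof cases
        case 1
        then have "n = emp" by (intro ext) simp
        then show ?thesis using emp_omega by simp
      next
        case 2
        then have "n = suc m" by (intro ext) auto
        then show ?thesis using 2 IH suc_omega by blast
      qed
    qed
  qed
  moreover have "n \<epsilon> omega \<Longrightarrow> n \<epsilon> j omega"
    using j_omega_mem[of n] j_mem[of n omega] by simp
  ultimately show "n \<epsilon> j omega \<longleftrightarrow> n \<epsilon> omega" by blast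
qed

text \<open>The bounds \<open>a\<close> and \<open>b\<close> on arguments and values are what makes
  functionality a Delta0 statement.\<close>

lemma j_single_valued:
  assumes "\<And>n y y'. n \<epsilon> a \<Longrightarrow> y \<epsilon> b \<Longrightarrow> y' \<epsilon> b \<Longrightarrow> pr n y \<epsilon> s \<Longrightarrow> pr n y' \<epsilon> s \<Longrightarrow> y = y'"
    and "n \<epsilon> j a" "y \<epsilon> j b" "y' \<epsilon> j b" "pr n y \<epsilon> j s" "pr n y' \<epsilon> j s"
  shows "y = y'"
proof -
  have 1: "delta0 (BallF 3 1 (BallF 4 2 (BallF 5 2 (BallF 6 0 (BallF 7 0
      (ImpF (And (OpairF 3 4 6) (OpairF 3 5 7)) (Eq 4 5)))))))"
    by (intro delta0.intros delta0_OpairF) simp_all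
  from j_delta0[OF 1, of "undefined(0 := s, 1 := a, 2 := b)"] show ?thesis
    using assms by simp
qed

text \<open>Continuity of \<open>j\<close> at \<open>\<omega>\<close>-unions.\<close>

lemma j_omega_cover:
  assumes F: "cfn \<C> F" and A: "\<And>v. v \<epsilon> A \<Longrightarrow> \<exists>n. n \<epsilon> omega \<and> v \<epsilon> F n" and v: "v \<epsilon> j A"
  shows "\<exists>n. n \<epsilon> omega \<and> v \<epsilon> j (F n)"
proof -
  let ?s = "lam F omega" and ?b = "img F omega"
  have 1: "delta0 (BallF 4 3 (BexF 5 1 (BexF 6 2 (And (BexF 7 0 (OpairF 5 6 7)) (Mem 4 6)))))"
    by (intro delta0.intros delta0_OpairF) simp_all
  have "\<forall>v. v \<epsilon> A \<longrightarrow> (\<exists>n. n \<epsilon> omega \<and> (\<exists>y. pr n y \<epsilon> ?s \<and> y \<epsilon> ?b \<and> v \<epsilon> y))"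
    using A F by fastforce
  then have "\<forall>v. v \<epsilon> j A \<longrightarrow> (\<exists>n. n \<epsilon> j omega \<and> (\<exists>y. pr n y \<epsilon> j ?s \<and> y \<epsilon> j ?b \<and> v \<epsilon> y))"
    using j_delta0[OF 1, of "undefined(0 := ?s, 1 := omega, 2 := ?b, 3 := A)"] by simp
  \<comment> \<open>The index \<open>n\<close> is a true natural number because
    \<open>j omega = omega\<close>; it remains to identify the value \<open>y\<close> of the
    transferred sequence at \<open>n\<close>. Since \<open>j n = n\<close>, that value is
    \<open>j (F n)\<close>.\<close>
  then obtain n y where n: "n \<epsilon> omega" and y: "y \<epsilon> j ?b" "pr n y \<epsilon> j ?s" "v \<epsilon> y"
    using v j_omega by metis
  have "pr n (F n) \<epsilon> ?s" "F n \<epsilon> ?b" using n F by auto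
  then have "j (pr n (F n)) \<epsilon> j ?s" "j (F n) \<epsilon> j ?b" by (simp_all only: j_mem)
  then have "pr n (j (F n)) \<epsilon> j ?s" "j (F n) \<epsilon> j ?b"
    by (simp_all only: j_pr j_omega_mem[OF n])
  then have "y = j (F n)"
    using y n by (intro j_single_valued[of omega ?b ?s n y]) (auto simp: j_omega F)
  then show ?thesis using n y by blast
qed

lemma j_injections:
  assumes "\<And>x. x \<epsilon> l \<Longrightarrow> \<exists>i. i \<epsilon> I \<and> (\<forall>a. a \<epsilon> x \<longrightarrow> (\<exists>d. d \<epsilon> D \<and> pr a d \<epsilon> i)) \<and>
      (\<forall>a b d. a \<epsilon> x \<longrightarrow> b \<epsilon> x \<longrightarrow> d \<epsilon> D \<longrightarrow> pr b d \<epsilon> i \<longrightarrow> pr a d \<epsilon> i \<longrightarrow> a = b)"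
    and "x \<epsilon> j l"
  shows "\<exists>i. (\<forall>a. a \<epsilon> x \<longrightarrow> (\<exists>d. d \<epsilon> j D \<and> pr a d \<epsilon> i)) \<and>
      (\<forall>a b d. a \<epsilon> x \<longrightarrow> b \<epsilon> x \<longrightarrow> d \<epsilon> j D \<longrightarrow> pr b d \<epsilon> i \<longrightarrow> pr a d \<epsilon> i \<longrightarrow> a = b)"
proof -
  have 1: "delta0 (BallF 3 0 (BexF 4 1 (And (BallF 5 3 (BexF 6 2 (BexF 7 4 (OpairF 5 6 7))))
      (BallF 5 3 (BallF 6 3 (BallF 7 2 (BallF 8 4 (BallF 9 4
        (ImpF (And (OpairF 5 7 8) (OpairF 6 7 9)) (Eq 5 6))))))))))"
    by (intro delta0.intros delta0_OpairF) simp_all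
  have "\<forall>x. x \<epsilon> l \<longrightarrow> (\<exists>i. i \<epsilon> I \<and> (\<forall>a. a \<epsilon> x \<longrightarrow> (\<exists>d. d \<epsilon> D \<and> pr a d \<epsilon> i)) \<and>
      (\<forall>a. a \<epsilon> x \<longrightarrow> (\<forall>b. b \<epsilon> x \<longrightarrow> (\<forall>d. d \<epsilon> D \<longrightarrow> pr b d \<epsilon> i \<longrightarrow> pr a d \<epsilon> i \<longrightarrow> a = b))))"
    using assms(1) by meson
  then have "\<forall>x. x \<epsilon> j l \<longrightarrow> (\<exists>i. i \<epsilon> j I \<and> (\<forall>a. a \<epsilon> x \<longrightarrow> (\<exists>d. d \<epsilon> j D \<and> pr a d \<epsilon> i)) \<and>
      (\<forall>a. a \<epsilon> x \<longrightarrow> (\<forall>b. b \<epsilon> x \<longrightarrow> (\<forall>d. d \<epsilon> j D \<longrightarrow> pr b d \<epsilon> i \<longrightarrow> pr a d \<epsilon> i \<longrightarrow> a = b))))"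
    using j_delta0[OF 1, of "undefined(0 := l, 1 := I, 2 := D)"] by simp
  from this[THEN spec, THEN mp, OF assms(2)] show ?thesis
    by (elim exE conjE, intro exI conjI) simp_all
qed

lemma ex_closed_set:
  "\<exists>D. x \<epsilon> D \<and> transitive_set E D \<and> (\<forall>a b. a \<epsilon> D \<longrightarrow> b \<epsilon> D \<longrightarrow> pr a b \<epsilon> D) \<and>
    (\<forall>n. n \<epsilon> omega \<longrightarrow> n \<epsilon> D) \<and> (\<forall>z. z \<epsilon> j D \<longrightarrow> z \<epsilon> D)"
proof -
  \<comment> \<open>With \<open>w\<close> the set of earlier stages, the pieces put in
    \<open>x\<close>, all subsets of the union of these stages (two steps later, pairs), the members
    of \<open>j\<close> of each stage, and the members of members.\<close>
  define G :: "'a \<Rightarrow> 'a \<Rightarrow> 'a" where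
    "G n w = bun (upr x x) (bun (Po (Uni w)) (bun (Uni (img j w)) (Uni (Uni w))))" for n w
  define F where "F = recur G"
  have G: "cfn \<C> (\<lambda>p. G (p1 p) (p2 p))" unfolding G_def by (intro cl)
  have F: "cfn \<C> F" unfolding F_def by (rule cfn_recur[OF G])
  have memF: "z \<epsilon> F n \<longleftrightarrow> z = x \<or> (\<forall>w. w \<epsilon> z \<longrightarrow> (\<exists>m. m \<epsilon> n \<and> w \<epsilon> F m)) \<or>
      (\<exists>m. m \<epsilon> n \<and> z \<epsilon> j (F m)) \<or> (\<exists>m y. m \<epsilon> n \<and> y \<epsilon> F m \<and> z \<epsilon> y)"
    if "n \<epsilon> omega" for z n
  proof -
    have Fn: "F n = G n (img F n)"
      unfolding F_def using recur[OF G] Ord_omega_mem that by blast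
    show ?thesis
      unfolding Fn G_def
      by (simp only: mem_bun mem_upr mem_Po mem_Uni mem_img[OF F] mem_img[OF cfn_j]) blast
  qed
  have mono: "z \<epsilon> F n" if "m \<epsilon> n" "n \<epsilon> omega" "z \<epsilon> F m" for m n z
  proof -
    have "m \<epsilon> omega" "\<And>k. k \<epsilon> m \<Longrightarrow> k \<epsilon> n"
      using that omega_trans Ord_trans Ord_omega_mem by blast+
    then show ?thesis using that(3) unfolding memF[OF that(2)] memF[OF \<open>m \<epsilon> omega\<close>] by blast
  qed
  define D where "D = Uni (img F omega)"
  have D: "z \<epsilon> D \<longleftrightarrow> (\<exists>n. n \<epsilon> omega \<and> z \<epsilon> F n)" for z
    using F by (auto simp: D_def)
  have common: "\<exists>k. k \<epsilon> omega \<and> a \<epsilon> F k \<and> b \<epsilon> F k" if ab: "a \<epsilon> D" "b \<epsilon> D" for a b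
  proof -
    obtain n m where nm: "n \<epsilon> omega" "a \<epsilon> F n" "m \<epsilon> omega" "b \<epsilon> F m" using ab D by blast
    then have "n \<epsilon> m \<or> n = m \<or> m \<epsilon> n" using Ord_linear Ord_omega_mem by blast
    then show ?thesis using nm mono by blast
  qed
  have sub: "z \<epsilon> F (suc k)" if "k \<epsilon> omega" "\<And>w. w \<epsilon> z \<Longrightarrow> w \<epsilon> F k" for k z
    using that memF[OF suc_omega] by auto
  have "x \<epsilon> D" using D memF emp_omega by blast
  moreover have "transitive_set E D"
    unfolding transitive_set_def
  proof (intro allI impI)
    fix y z assume "y \<epsilon> D" "z \<epsilon> y"
    then obtain n where n: "n \<epsilon> omega" "y \<epsilon> F n" using D by blast
    then have "z \<epsilon> F (suc n)"
      using \<open>z \<epsilon> y\<close> memF[OF suc_omega[OF n(1)]] by auto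
    then show "z \<epsilon> D" using D n suc_omega by blast
  qed
  moreover have "pr a b \<epsilon> D" if ab: "a \<epsilon> D" "b \<epsilon> D" for a b
  proof -
    obtain k where k: "k \<epsilon> omega" "a \<epsilon> F k" "b \<epsilon> F k" using common[OF ab] by blast
    then have "upr a a \<epsilon> F (suc k)" "upr a b \<epsilon> F (suc k)" by (auto intro!: sub)
    then have "pr a b \<epsilon> F (suc (suc k))"
      unfolding pr_def using k suc_omega by (auto intro!: sub simp del: mem_suc)
    then show ?thesis using D k suc_omega by blast
  qed
  moreover have "n \<epsilon> D" if n: "n \<epsilon> omega" for n
  proof -
    have "\<forall>m. m \<epsilon> n \<longrightarrow> m \<epsilon> F n"
    proof (rule omega_induct[OF _ n])
      show "cls \<C> (\<lambda>n. \<forall>m. m \<epsilon> n \<longrightarrow> m \<epsilon> F n)" by (intro cl cfn_comp[OF fam_C F])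
      fix n assume n: "n \<epsilon> omega" and IH: "\<forall>m. m \<epsilon> n \<longrightarrow> m \<epsilon> F n"
      have "n \<epsilon> F (suc n)" using n IH by (intro sub) auto
      moreover have "m \<epsilon> F (suc n)" if "m \<epsilon> n" for m
        using that IH n suc_omega by (intro mono[of n "suc n"]) auto
      ultimately show "\<forall>m. m \<epsilon> suc n \<longrightarrow> m \<epsilon> F (suc n)" by auto
    qed auto
    then have "n \<epsilon> F (suc n)" using n by (intro sub) auto
    then show ?thesis using D n suc_omega by blast
  qed
  \<comment> \<open>Closure after only omega steps rests on continuity: a member of
    \<open>j D\<close> already lies in \<open>j\<close> of some stage.\<close>
  moreover have "z \<epsilon> D" if z: "z \<epsilon> j D" for z
  proof -
    obtain n where n: "n \<epsilon> omega" "z \<epsilon> j (F n)"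
      using j_omega_cover[OF F _ z] D by blast
    then have "z \<epsilon> F (suc n)" using memF[OF suc_omega[OF n(1)]] by auto
    then show ?thesis using D n suc_omega by blast
  qed
  ultimately show ?thesis by blast
qed

end

section \<open>The Hartogs number\<close>

locale closed_set = embedded +
  fixes D :: 'a
  assumes D_pr: "a \<epsilon> D \<Longrightarrow> b \<epsilon> D \<Longrightarrow> pr a b \<epsilon> D"
    and omega_D: "n \<epsilon> omega \<Longrightarrow> n \<epsilon> D"
    and j_D: "z \<epsilon> j D \<Longrightarrow> z \<epsilon> D"
begin

definition inj_into :: "'a \<Rightarrow> 'a \<Rightarrow> bool" where
  "inj_into i A \<longleftrightarrow> (\<forall>a. a \<epsilon> A \<longrightarrow> app i a \<epsilon> D) \<and>
     (\<forall>a b. a \<epsilon> A \<longrightarrow> b \<epsilon> A \<longrightarrow> app i a = app i b \<longrightarrow> a = b)"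

text \<open>Cardinality at most that of \<open>D\<close>.\<close>

definition small :: "'a \<Rightarrow> bool" where
  "small A \<longleftrightarrow> (\<exists>i. inj_into i A)"

lemma cls_inj_into [cl]:
  assumes "cfn \<C> f" "cfn \<C> g" shows "cls \<C> (\<lambda>c. inj_into (f c) (g c))"
  unfolding inj_into_def by (intro cl cfn_comp[OF fam_C assms(1)] cfn_comp[OF fam_C assms(2)])

lemma cls_small [cl]:
  assumes "cfn \<C> f" shows "cls \<C> (\<lambda>c. small (f c))"
  unfolding small_def by (intro cl cfn_comp[OF fam_C assms])

lemma smallI:
  assumes "cfn \<C> h" "\<And>a. a \<epsilon> A \<Longrightarrow> h a \<epsilon> D" "\<And>a b. a \<epsilon> A \<Longrightarrow> b \<epsilon> A \<Longrightarrow> h a = h b \<Longrightarrow> a = b"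
  shows "small A"
  unfolding small_def inj_into_def using assms by (intro exI[of _ "lam h A"]) auto

lemma small_subset: "small B \<Longrightarrow> (\<And>a. a \<epsilon> A \<Longrightarrow> a \<epsilon> B) \<Longrightarrow> small A"
  unfolding small_def inj_into_def by blast

lemma small_in_D: "(\<And>a. a \<epsilon> A \<Longrightarrow> a \<epsilon> D) \<Longrightarrow> small A"
  by (rule smallI[of "\<lambda>a. a"]) (auto intro!: cl)

text \<open>Injections are chosen uniformly, as a class function of \<open>A\<close>. An arbitrary
  injection is first cut down to its graph in \<open>cart A D\<close>, so that the choice is from a
  set.\<close>

definition einj :: "'a \<Rightarrow> 'a" where
  "einj A = ch (sep (Po (cart A D)) (\<lambda>i. inj_into i A))"

lemma cfn_einj [cl]: assumes "cfn \<C> f" shows "cfn \<C> (\<lambda>c. einj (f c))"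
  unfolding einj_def by (intro cl assms cfn_comp[OF fam_C assms])

lemma inj_into_einj: assumes "small A" shows "inj_into (einj A) A"
proof -
  obtain i where i: "inj_into i A" using assms by (auto simp: small_def)
  have c: "cfn \<C> (app i)" by (intro cl)
  have s: "cls \<C> (\<lambda>i. inj_into i A)" by (intro cl)
  have "lam (app i) A \<epsilon> sep (Po (cart A D)) (\<lambda>i. inj_into i A)"
    using i c s by (auto simp: inj_into_def)
  from ch_mem[OF this] show ?thesis using s by (simp add: einj_def)
qed

text \<open>The order is taken reflexive so that the field of \<open>R\<close> is the whole image of \<open>A\<close>.\<close>

definition codes :: "'a \<Rightarrow> 'a \<Rightarrow> 'a \<Rightarrow> bool" where
  "codes R i A \<longleftrightarrow> inj_into i A \<and> (\<forall>u v. pr u v \<epsilon> R \<longleftrightarrow>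
     (\<exists>a b. a \<epsilon> A \<and> b \<epsilon> A \<and> u = app i a \<and> v = app i b \<and> (a \<epsilon> b \<or> a = b)))"

lemma cls_codes:
  assumes "cfn \<C> f" "cfn \<C> g" "cfn \<C> h" shows "cls \<C> (\<lambda>c. codes (f c) (g c) (h c))"
  unfolding codes_def
  by (intro cl assms cfn_comp[OF fam_C assms(1)] cfn_comp[OF fam_C assms(2)] cfn_comp[OF fam_C assms(3)])

text \<open>Both ordinals are isomorphic to the order coded by \<open>R\<close>, and an isomorphism
  of ordinals is the identity, by induction on membership.\<close>

lemma codes_unique:
  assumes A: "Ord A" "codes R i A" and B: "Ord B" "codes R k B"
  shows "A = B"
proof -
  have i: "a \<epsilon> A \<Longrightarrow> b \<epsilon> A \<Longrightarrow> app i a = app i b \<Longrightarrow> a = b"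
    and k: "a \<epsilon> B \<Longrightarrow> b \<epsilon> B \<Longrightarrow> app k a = app k b \<Longrightarrow> a = b" for a b
    using A B by (auto simp: codes_def inj_into_def)
  have Ri: "pr u v \<epsilon> R \<longleftrightarrow> (\<exists>a b. a \<epsilon> A \<and> b \<epsilon> A \<and> u = app i a \<and> v = app i b \<and> (a \<epsilon> b \<or> a = b))"
    and Rk: "pr u v \<epsilon> R \<longleftrightarrow> (\<exists>a b. a \<epsilon> B \<and> b \<epsilon> B \<and> u = app k a \<and> v = app k b \<and> (a \<epsilon> b \<or> a = b))"
    for u v using A B by (auto simp: codes_def)
  have eq: "a \<epsilon> A \<longrightarrow> (\<forall>b. b \<epsilon> B \<longrightarrow> app i a = app k b \<longrightarrow> a = b)" for a
  proof (rule eps_induct[of _ a])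
    show "cls \<C> (\<lambda>a. a \<epsilon> A \<longrightarrow> (\<forall>b. b \<epsilon> B \<longrightarrow> app i a = app k b \<longrightarrow> a = b))" by (intro cl)
    fix a assume IH: "\<And>z. z \<epsilon> a \<Longrightarrow> z \<epsilon> A \<longrightarrow> (\<forall>b. b \<epsilon> B \<longrightarrow> app i z = app k b \<longrightarrow> z = b)"
    show "a \<epsilon> A \<longrightarrow> (\<forall>b. b \<epsilon> B \<longrightarrow> app i a = app k b \<longrightarrow> a = b)"
    proof (intro impI allI)
      fix b assume a: "a \<epsilon> A" and b: "b \<epsilon> B" and ab: "app i a = app k b"
      show "a = b"
      proof (rule ext)
        fix z
        show "z \<epsilon> a \<longleftrightarrow> z \<epsilon> b"
        proof
          assume z: "z \<epsilon> a"
          then have zA: "z \<epsilon> A" using Ord_trans A(1) a by blast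
          then have "pr (app i z) (app i a) \<epsilon> R" using z a Ri by blast
          then obtain c b' where c: "c \<epsilon> B" "b' \<epsilon> B" "app i z = app k c" "app i a = app k b'"
            "c \<epsilon> b' \<or> c = b'" using Rk by blast
          then have "b' = b" using k b ab by metis
          \<comment> \<open>The coded order is reflexive, so equality must be excluded separately:
            it would give \<open>z = a\<close>.\<close>
          moreover have "c \<noteq> b'" using c i[OF zA a] z mem_irrefl by metis
          ultimately show "z \<epsilon> b" using c IH[OF z] zA by blast
        next
          assume z: "z \<epsilon> b"
          then have zB: "z \<epsilon> B" using Ord_trans B(1) b by blast
          then have "pr (app k z) (app k b) \<epsilon> R" using z b Rk by blast
          then obtain c a' where c: "c \<epsilon> A" "a' \<epsilon> A" "app k z = app i c" "app k b = app i a'"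
            "c \<epsilon> a' \<or> c = a'" using Ri by blast
          then have "a' = a" using i a ab by metis
          moreover have "c \<noteq> a'" using c k[OF zB b] z mem_irrefl by metis
          ultimately show "z \<epsilon> a" using c IH zB by metis
        qed
      qed
    qed
  qed
  show ?thesis
  proof (rule ext)
    fix z
    have "\<exists>b. b \<epsilon> B \<and> app i z = app k b" if "z \<epsilon> A" using that Ri Rk by blast
    moreover have "\<exists>a. a \<epsilon> A \<and> app k z = app i a" if "z \<epsilon> B" using that Ri Rk by blast
    ultimately show "z \<epsilon> A \<longleftrightarrow> z \<epsilon> B" using eq by metis
  qed
qed

text \<open>Closure under pairs makes a relation on \<open>D\<close> a subset of \<open>D\<close>,
  so the codes range over the set \<open>Po D\<close>.\<close>

lemma codes_exists: assumes "inj_into i A" shows "\<exists>R. R \<epsilon> Po D \<and> codes R i A"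
proof -
  let ?P = "\<lambda>p. p1 p \<epsilon> p2 p \<or> p1 p = p2 p" and ?h = "\<lambda>p. pr (app i (p1 p)) (app i (p2 p))"
  let ?R = "img ?h (sep (cart A A) ?P)"
  have P: "cls \<C> ?P" and h: "cfn \<C> ?h" by (intro cl)+
  have "z \<epsilon> ?R \<longleftrightarrow>
      (\<exists>a b. a \<epsilon> A \<and> b \<epsilon> A \<and> z = pr (app i a) (app i b) \<and> (a \<epsilon> b \<or> a = b))" for z
    unfolding mem_img[OF h] mem_sep[OF P] mem_cart by (auto; metis p1_pr p2_pr)
  moreover from this have "?R \<epsilon> Po D" using assms D_pr by (auto simp: inj_into_def)
  ultimately show ?thesis using assms by (intro exI[of _ ?R]) (auto simp: codes_def)
qed

text \<open>Small ordinals are images of their codes in \<open>Po D\<close>; by replacement they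
  form part of a set, which cannot contain all ordinals.\<close>

lemma hartogs: "\<exists>A. Ord A \<and> \<not> small A"
proof -
  define r where "r R = the1 (\<lambda>A. Ord A \<and> (\<exists>i. codes R i A))" for R
  have r: "cfn \<C> r" unfolding r_def by (intro cl cls_codes)
  obtain A where A: "Ord A" "\<not> A \<epsilon> img r (Po D)" using Ord_unbounded by blast
  have "\<not> small A"
  proof
    assume "small A"
    then obtain i R where R: "R \<epsilon> Po D" "codes R i A" using codes_exists unfolding small_def by blast
    then have "r R = A"
      unfolding r_def using A codes_unique by (intro the1_equality) blast+
    then have "A \<epsilon> img r (Po D)" using R r by auto
    then show False using A by blast
  qed
  then show ?thesis using A by blast
qed

definition l :: 'a where "l = lst (\<lambda>A. \<not> small A)"

lemma Ord_l: "Ord l" and l_not_small: "\<not> small l" and l_small: "a \<epsilon> l \<Longrightarrow> small a"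
proof -
  obtain A where A: "Ord A" "\<not> small A" using hartogs by blast
  have c: "cls \<C> (\<lambda>A. \<not> small A)" by (intro cl)
  show "Ord l" "\<not> small l" "a \<epsilon> l \<Longrightarrow> small a"
    unfolding l_def using lst[OF c A] by auto
qed

lemma mem_lI: assumes "Ord a" "small a" shows "a \<epsilon> l"
  using Ord_not_mem[OF assms(1) Ord_l] small_subset[OF assms(2)] l_not_small by blast

lemma Ord_mem_l: "a \<epsilon> l \<Longrightarrow> Ord a"
  using Ord_mem Ord_l by blast

lemma l_trans: "a \<epsilon> l \<Longrightarrow> b \<epsilon> a \<Longrightarrow> b \<epsilon> l"
  using Ord_trans Ord_l by blast

lemma suc_l: assumes a: "a \<epsilon> l" shows "suc a \<epsilon> l"
proof (rule mem_lI)
  show "Ord (suc a)" using a Ord_mem_l Ord_suc by blast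
  obtain i where i: "inj_into i a" using l_small[OF a] by (auto simp: small_def)
  have e: "emp \<epsilon> D" "suc emp \<epsilon> D" using omega_D emp_omega suc_omega by blast+
  have ne: "emp \<noteq> suc emp" using mem_suc[of emp emp] mem_emp by metis
  show "small (suc a)"
  proof (rule smallI)
    \<comment> \<open>The tags \<open>emp\<close> and \<open>suc emp\<close> in the first coordinate
      keep the code of the new element \<open>a\<close> apart from the old ones.\<close>
    show "cfn \<C> (\<lambda>z. if z = a then pr (suc emp) emp else pr emp (app i z))" by (intro cl)
  qed (use i e ne D_pr in \<open>auto simp: inj_into_def split: if_splits\<close>)
qed

lemma l_max: assumes "a \<epsilon> l" "b \<epsilon> l"
  shows "\<exists>c. c \<epsilon> l \<and> (\<forall>z. z \<epsilon> a \<longrightarrow> z \<epsilon> c) \<and> (\<forall>z. z \<epsilon> b \<longrightarrow> z \<epsilon> c)"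
  using Ord_linear[of a b] Ord_trans[of a b] Ord_trans[of b a] Ord_mem_l assms by blast

text \<open>If there were not even a weak bound, each \<open>b\<close> in \<open>l\<close> would lie
  in some \<open>h a\<close>. Pairing the code of such an \<open>a\<close> with the code of
  \<open>b\<close> under the chosen injection of \<open>h a\<close> would inject \<open>l\<close>
  into \<open>D\<close>. The successor of a weak bound is a strict one.\<close>

lemma l_regular:
  assumes h: "cfn \<C> h" and A: "small A" and hA: "\<And>a. a \<epsilon> A \<Longrightarrow> h a \<epsilon> l"
  shows "\<exists>b. b \<epsilon> l \<and> (\<forall>a. a \<epsilon> A \<longrightarrow> h a \<epsilon> b)"
proof -
  have "\<exists>b. b \<epsilon> l \<and> (\<forall>a. a \<epsilon> A \<longrightarrow> \<not> b \<epsilon> h a)"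
  proof (rule ccontr)
    assume n: "\<nexists>b. b \<epsilon> l \<and> (\<forall>a. a \<epsilon> A \<longrightarrow> \<not> b \<epsilon> h a)"
    obtain i where i: "inj_into i A" using A by (auto simp: small_def)
    define c where "c b = ch (sep A (\<lambda>a. b \<epsilon> h a))" for b
    have c: "c b \<epsilon> A" "b \<epsilon> h (c b)" if b: "b \<epsilon> l" for b
    proof -
      have s: "cls \<C> (\<lambda>a. b \<epsilon> h a)" by (intro cl cfn_comp[OF fam_C h])
      obtain a where "a \<epsilon> A" "b \<epsilon> h a" using n b by blast
      then have "a \<epsilon> sep A (\<lambda>a. b \<epsilon> h a)" using s by simp
      from ch_mem[OF this] show "c b \<epsilon> A" "b \<epsilon> h (c b)" using s by (auto simp: c_def)
    qed
    have e: "inj_into (einj (h (c b))) (h (c b))" if "b \<epsilon> l" for b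
      using inj_into_einj l_small hA c(1)[OF that] by blast
    have "small l"
    proof (rule smallI)
      show "cfn \<C> (\<lambda>b. pr (app i (c b)) (app (einj (h (c b))) b))"
        unfolding c_def by (intro cl cfn_comp[OF fam_C h])
      show "pr (app i (c b)) (app (einj (h (c b))) b) \<epsilon> D" if "b \<epsilon> l" for b
        using c[OF that] e[OF that] i by (intro D_pr) (auto simp: inj_into_def)
      fix a b assume ab: "a \<epsilon> l" "b \<epsilon> l"
        and eq: "pr (app i (c a)) (app (einj (h (c a))) a) = pr (app i (c b)) (app (einj (h (c b))) b)"
      then have "c a = c b" using i c by (auto simp: inj_into_def)
      then show "a = b" using eq e[OF ab(1)] c(2)[OF ab(1)] c(2)[OF ab(2)] by (auto simp: inj_into_def)
    qed
    then show False using l_not_small by blast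
  qed
  then obtain b where b: "b \<epsilon> l" "\<And>a. a \<epsilon> A \<Longrightarrow> \<not> b \<epsilon> h a" by blast
  then have "h a \<epsilon> suc b" if "a \<epsilon> A" for a
    using Ord_linear[of "h a" b] Ord_mem_l hA that by auto
  then show ?thesis using suc_l b by blast
qed

lemma j_l: "j l = l"
proof -
  \<comment> \<open>The graphs \<open>J x\<close> form a set, which supplies the bound on injections
    in \<open>j_injections\<close>.\<close>
  define J where "J A = lam (app (einj A)) A" for A
  have J: "cfn \<C> J" unfolding J_def by (intro cl)
  have app: "cfn \<C> (app i)" for i by (intro cl)
  have "\<not> l \<epsilon> j l"
  proof
    assume l: "l \<epsilon> j l"
    have "\<exists>i. (\<forall>a. a \<epsilon> l \<longrightarrow> (\<exists>d. d \<epsilon> j D \<and> pr a d \<epsilon> i)) \<and>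
      (\<forall>a b d. a \<epsilon> l \<longrightarrow> b \<epsilon> l \<longrightarrow> d \<epsilon> j D \<longrightarrow> pr b d \<epsilon> i \<longrightarrow> pr a d \<epsilon> i \<longrightarrow> a = b)"
    proof (rule j_injections[OF _ l, of "img J l"])
      fix x assume x: "x \<epsilon> l"
      have "J x \<epsilon> img J l" using x J by auto
      then show "\<exists>i. i \<epsilon> img J l \<and> (\<forall>a. a \<epsilon> x \<longrightarrow> (\<exists>d. d \<epsilon> D \<and> pr a d \<epsilon> i)) \<and>
        (\<forall>a b d. a \<epsilon> x \<longrightarrow> b \<epsilon> x \<longrightarrow> d \<epsilon> D \<longrightarrow> pr b d \<epsilon> i \<longrightarrow> pr a d \<epsilon> i \<longrightarrow> a = b)"
        using inj_into_einj[OF l_small[OF x]]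
        by (intro exI[of _ "J x"]) (auto simp: J_def app inj_into_def)
    qed
    then obtain i where i: "\<And>a. a \<epsilon> l \<Longrightarrow> \<exists>d. d \<epsilon> j D \<and> pr a d \<epsilon> i"
      "\<And>a b d. a \<epsilon> l \<Longrightarrow> b \<epsilon> l \<Longrightarrow> d \<epsilon> j D \<Longrightarrow> pr b d \<epsilon> i \<Longrightarrow> pr a d \<epsilon> i \<Longrightarrow> a = b" by blast
    \<comment> \<open>The transferred \<open>i\<close> may relate \<open>a\<close> to several
      \<open>d\<close>. Any choice among them is injective, because distinct \<open>a\<close> share
      no \<open>d\<close>.\<close>
    define h where "h a = ch (sep (j D) (\<lambda>d. pr a d \<epsilon> i))" for a
    have h: "h a \<epsilon> j D" "pr a (h a) \<epsilon> i" if a: "a \<epsilon> l" for a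
    proof -
      have s: "cls \<C> (\<lambda>d. pr a d \<epsilon> i)" by (intro cl)
      obtain d where "d \<epsilon> sep (j D) (\<lambda>d. pr a d \<epsilon> i)" using i(1)[OF a] s by auto
      from ch_mem[OF this] show "h a \<epsilon> j D" "pr a (h a) \<epsilon> i" using s by (auto simp: h_def)
    qed
    have "small l"
    proof (rule smallI)
      show "cfn \<C> h" unfolding h_def by (intro cl)
      show "h a \<epsilon> D" if "a \<epsilon> l" for a using h that j_D by blast
      show "a = b" if "a \<epsilon> l" "b \<epsilon> l" "h a = h b" for a b using h i(2) that by metis
    qed
    then show False using l_not_small by blast
  qed
  moreover have "\<not> j l \<epsilon> l" using j_not_below Ord_l by blast
  ultimately show ?thesis using Ord_linear[OF j_Ord[OF Ord_l] Ord_l] by blast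
qed

lemma j_mem_l: "j a \<epsilon> l \<longleftrightarrow> a \<epsilon> l"
  using j_mem[of a l] j_l by simp

text \<open>\<open>a\<close> is at most \<open>j a\<close>, which is below \<open>suc (j a)\<close>.
  This gives cofinality of \<open>j\<close> in \<open>l\<close>.\<close>

lemma mem_j_suc: assumes "a \<epsilon> l" shows "a \<epsilon> j (suc a)"
  using Ord_linear[of a "j a"] j_not_below[of a] j_Ord[of a] Ord_mem_l[OF assms]
  by (auto simp: j_suc)

end

context NGBC
begin

section \<open>Stationary sets\<close>

text \<open>The cofinal sequence is any set of the universe, not of an inner model. Strict
  domination excludes 0 and successors among the ordinals.\<close>

definition cofw :: "'v \<Rightarrow> bool" where
  "cofw x \<longleftrightarrow> (\<exists>s. (\<forall>n. n \<epsilon> omega \<longrightarrow> app s n \<epsilon> x) \<and>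
     (\<forall>z. z \<epsilon> x \<longrightarrow> (\<exists>n. n \<epsilon> omega \<and> z \<epsilon> app s n)))"

lemma cls_cofw [cl]: assumes "fam K" "cfn K f" shows "cls K (\<lambda>c. cofw (f c))"
  unfolding cofw_def by (intro cl assms(1) cfn_comp[OF assms])

lemma cofwI:
  assumes "cfn \<C> s" "\<And>n. n \<epsilon> omega \<Longrightarrow> s n \<epsilon> x"
    "\<And>z. z \<epsilon> x \<Longrightarrow> \<exists>n. n \<epsilon> omega \<and> z \<epsilon> s n"
  shows "cofw x"
  unfolding cofw_def using assms by (intro exI[of _ "lam s omega"]) (auto; metis app_lam)

text \<open>For regular uncountable \<open>L\<close>: the set of points of cofinality \<open>\<omega>\<close> in \<open>P\<close> is stationary
  in \<open>L\<close>.\<close>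

definition stationary :: "'v \<Rightarrow> ('v \<Rightarrow> bool) \<Rightarrow> bool" where
  "stationary L P \<longleftrightarrow> (\<forall>F. (\<forall>a. a \<epsilon> L \<longrightarrow> app F a \<epsilon> L) \<longrightarrow>
     (\<exists>x. x \<epsilon> L \<and> cofw x \<and> (\<forall>a. a \<epsilon> x \<longrightarrow> app F a \<epsilon> x) \<and> P x))"

lemma cls_stationary [cl]:
  assumes "fam K" "cfn K f" "cls K (\<lambda>c. P (p1 c) (p2 c))"
  shows "cls K (\<lambda>c. stationary (f c) (P c))"
  unfolding stationary_def
  by (intro cl assms(1) cfn_comp[OF assms(1,2)] cls_comp2[OF assms(1,3)])

lemma stationaryD:
  assumes "stationary L P" "cfn \<C> F" "\<And>a. a \<epsilon> L \<Longrightarrow> F a \<epsilon> L" "Ord L"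
  shows "\<exists>x. x \<epsilon> L \<and> cofw x \<and> (\<forall>a. a \<epsilon> x \<longrightarrow> F a \<epsilon> x) \<and> P x"
proof -
  have "\<forall>a. a \<epsilon> L \<longrightarrow> app (lam F L) a \<epsilon> L" using assms(2,3) by simp
  then obtain x where x: "x \<epsilon> L" "cofw x" "\<forall>a. a \<epsilon> x \<longrightarrow> app (lam F L) a \<epsilon> x" "P x"
    using assms(1) unfolding stationary_def by blast
  moreover have "F a \<epsilon> x" if "a \<epsilon> x" for a
    using x(3) that assms(2) Ord_trans[OF assms(4) x(1) that] by auto
  ultimately show ?thesis by blast
qed

end

section \<open>Closure points and the Ulam matrix\<close>

context closed_set
begin

text \<open>The limit of an omega-sequence in which each term bounds the earlier terms and the
  values of \<open>F\<close> below them.\<close>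

lemma ex_closed_point:
  assumes F: "cfn \<C> F" and Fl: "\<And>a. a \<epsilon> l \<Longrightarrow> F a \<epsilon> l" and b: "b \<epsilon> l"
  shows "\<exists>x. x \<epsilon> l \<and> b \<epsilon> x \<and> cofw x \<and> (\<forall>a. a \<epsilon> x \<longrightarrow> F a \<epsilon> x)"
proof -
  define Q where "Q w c \<longleftrightarrow> c \<epsilon> l \<and> b \<epsilon> c \<and>
    (\<forall>d. d \<epsilon> w \<longrightarrow> d \<epsilon> c \<and> (\<forall>a. a \<epsilon> d \<longrightarrow> F a \<epsilon> c))" for w c
  define G :: "'a \<Rightarrow> 'a \<Rightarrow> 'a" where "G n w = lst (Q w)" for n w
  define X where "X = recur G"
  have Q: "cls \<C> (Q w)" for w
    unfolding Q_def by (intro cl cfn_comp[OF fam_C F])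
  have G: "cfn \<C> (\<lambda>p. G (p1 p) (p2 p))"
    unfolding G_def Q_def by (intro cl cfn_comp[OF fam_C F])
  have X: "cfn \<C> X" unfolding X_def by (rule cfn_recur[OF G])
  have step: "Q (img X n) (X n)" if n: "n \<epsilon> omega" and Xm: "\<And>m. m \<epsilon> n \<Longrightarrow> X m \<epsilon> l" for n
  proof -
    have "small n" using n omega_trans omega_D by (intro small_in_D) blast
    from l_regular[OF X this Xm] obtain u where u: "u \<epsilon> l" "\<And>m. m \<epsilon> n \<Longrightarrow> X m \<epsilon> u" by blast
    have "\<And>a. a \<epsilon> u \<Longrightarrow> F a \<epsilon> l" using Fl u l_trans by blast
    from l_regular[OF F l_small[OF u(1)] this] obtain v
      where v: "v \<epsilon> l" "\<And>a. a \<epsilon> u \<Longrightarrow> F a \<epsilon> v" by blast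
    obtain w where w: "w \<epsilon> l" "\<forall>z. z \<epsilon> u \<longrightarrow> z \<epsilon> w" "\<forall>z. z \<epsilon> v \<longrightarrow> z \<epsilon> w"
      using l_max[OF u(1) v(1)] by blast
    obtain c where c: "c \<epsilon> l" "\<forall>z. z \<epsilon> w \<longrightarrow> z \<epsilon> c" "\<forall>z. z \<epsilon> suc b \<longrightarrow> z \<epsilon> c"
      using l_max[OF w(1) suc_l[OF b]] by blast
    have "F a \<epsilon> c" if "m \<epsilon> n" "a \<epsilon> X m" for m a
      using that c w v u Ord_trans[OF Ord_mem_l[OF u(1)]] by blast
    then have "Q (img X n) c"
      unfolding Q_def using c w u X by auto
    from lst(2)[OF Q Ord_mem_l[OF c(1)] this] have "Q (img X n) (G n (img X n))"
      by (simp add: G_def)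
    moreover have "X n = G n (img X n)"
      unfolding X_def by (rule recur[OF G Ord_omega_mem[OF n]])
    ultimately show ?thesis by simp
  qed
  have "n \<epsilon> omega \<longrightarrow> X n \<epsilon> l" for n
  proof (rule eps_induct[of _ n])
    show "cls \<C> (\<lambda>n. n \<epsilon> omega \<longrightarrow> X n \<epsilon> l)" by (intro cl cfn_comp[OF fam_C X])
    show "n \<epsilon> omega \<longrightarrow> X n \<epsilon> l" if "\<And>m. m \<epsilon> n \<Longrightarrow> m \<epsilon> omega \<longrightarrow> X m \<epsilon> l" for n
      using that step[of n] omega_trans by (auto simp: Q_def)
  qed
  then have Xl: "X n \<epsilon> l" if "n \<epsilon> omega" for n using that by blast
  have bX: "b \<epsilon> X n" if "n \<epsilon> omega" for n
    using step[OF that] Xl omega_trans[OF that] by (auto simp: Q_def)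
  have XX: "X n \<epsilon> X (suc n)" "a \<epsilon> X n \<Longrightarrow> F a \<epsilon> X (suc n)" if "n \<epsilon> omega" for n a
    using step[OF suc_omega[OF that]] Xl omega_trans[OF suc_omega[OF that]] X
    by (auto simp: Q_def)
  define x where "x = Uni (img X omega)"
  have x: "z \<epsilon> x \<longleftrightarrow> (\<exists>n. n \<epsilon> omega \<and> z \<epsilon> X n)" for z using X by (auto simp: x_def)
  \<comment> \<open>Uncountable cofinality of \<open>l\<close>: the natural numbers lie in
    \<open>D\<close>, so regularity applies to omega-sequences.\<close>
  have "small omega" using omega_D by (rule small_in_D)
  from l_regular[OF X this Xl] obtain u where u: "u \<epsilon> l" "\<And>n. n \<epsilon> omega \<Longrightarrow> X n \<epsilon> u" by blast
  have "Ord x" unfolding x_def using X Xl Ord_mem_l by (intro Ord_Uni) auto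
  moreover have "z \<epsilon> x \<Longrightarrow> z \<epsilon> u" for z using x u Ord_trans[OF Ord_mem_l[OF u(1)]] by blast
  ultimately have "x \<epsilon> l" using small_subset[OF l_small[OF u(1)]] by (intro mem_lI) blast+
  moreover have "b \<epsilon> x" using x bX emp_omega by blast
  moreover have "cofw x"
  proof (rule cofwI[OF X])
    show "X n \<epsilon> x" if "n \<epsilon> omega" for n using x XX(1)[OF that] suc_omega[OF that] by blast
  qed (use x in blast)
  moreover have "F a \<epsilon> x" if "a \<epsilon> x" for a using that x XX(2) suc_omega by blast
  ultimately show ?thesis by blast
qed

text \<open>The entries of the Ulam matrix given by the injections \<open>einj x\<close> of \<open>x \<epsilon> l\<close> into \<open>D\<close>.\<close>

definition ulam :: "'a \<Rightarrow> 'a \<Rightarrow> 'a \<Rightarrow> bool" where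
  "ulam d a x \<longleftrightarrow> a \<epsilon> x \<and> app (einj x) a = d"

lemma cls_ulam [cl]:
  assumes "cfn \<C> f" "cfn \<C> g" "cfn \<C> h" shows "cls \<C> (\<lambda>c. ulam (f c) (g c) (h c))"
  unfolding ulam_def by (intro cl assms)

text \<open>The entries of column \<open>a\<close>, over all rows \<open>d\<close>, cover the points
  of \<open>l\<close> above \<open>a\<close>. Were all nonstationary, a common closure point of the
  \<open>|D|\<close> many witnessing functions would lie in one of them.\<close>

lemma ulam_stationary: assumes a: "a \<epsilon> l" shows "\<exists>d. d \<epsilon> D \<and> stationary l (ulam d a)"
proof (rule ccontr)
  assume n: "\<nexists>d. d \<epsilon> D \<and> stationary l (ulam d a)"
  define W where "W d F \<longleftrightarrow> (\<forall>b. b \<epsilon> l \<longrightarrow> app F b \<epsilon> l) \<and>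
    \<not> (\<exists>x. x \<epsilon> l \<and> cofw x \<and> (\<forall>b. b \<epsilon> x \<longrightarrow> app F b \<epsilon> x) \<and> ulam d a x)" for d F
  define Fd where "Fd d = ch (sep (Po (cart l l)) (W d))" for d
  have Fd: "W d (Fd d)" if d: "d \<epsilon> D" for d
  proof -
    have W: "cls \<C> (W d)" unfolding W_def by (intro cl)
    obtain F where F: "W d F" using n d unfolding stationary_def W_def by blast
    have c: "cfn \<C> (app F)" by (intro cl)
    \<comment> \<open>Restricting the witness to \<open>l\<close> places it in the set
      \<open>Po (cart l l)\<close>, from which \<open>ch\<close> can choose.\<close>
    have "W d (lam (app F) l)"
      unfolding W_def
    proof (intro conjI notI)
      show "\<forall>b. b \<epsilon> l \<longrightarrow> app (lam (app F) l) b \<epsilon> l" using F c by (simp add: W_def)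
      assume "\<exists>x. x \<epsilon> l \<and> cofw x \<and> (\<forall>b. b \<epsilon> x \<longrightarrow> app (lam (app F) l) b \<epsilon> x) \<and> ulam d a x"
      then obtain x where x: "x \<epsilon> l" "cofw x" "\<forall>b. b \<epsilon> x \<longrightarrow> app (lam (app F) l) b \<epsilon> x" "ulam d a x"
        by blast
      then have "\<forall>b. b \<epsilon> x \<longrightarrow> app F b \<epsilon> x" using c l_trans by simp
      then show False using F x unfolding W_def by blast
    qed
    moreover have "lam (app F) l \<epsilon> Po (cart l l)" using F c by (auto simp: W_def)
    ultimately have "lam (app F) l \<epsilon> sep (Po (cart l l)) (W d)" using W by simp
    from ch_mem[OF this] show ?thesis using W by (simp add: Fd_def)
  qed
  have cFd: "cfn \<C> Fd" unfolding Fd_def W_def by (intro cl)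
  \<comment> \<open>A simultaneous bound at \<open>b\<close> for all witnesses, available by
    regularity; an ordinal closed under it is closed under every \<open>Fd d\<close>.\<close>
  define Q where "Q b c \<longleftrightarrow> c \<epsilon> l \<and> (\<forall>d. d \<epsilon> D \<longrightarrow> app (Fd d) b \<epsilon> c)" for b c
  have Q: "Q b (lst (Q b))" if b: "b \<epsilon> l" for b
  proof -
    have "small D" by (rule small_in_D)
    moreover have "cfn \<C> (\<lambda>d. app (Fd d) b)" by (intro cl cFd)
    moreover have "\<And>d. d \<epsilon> D \<Longrightarrow> app (Fd d) b \<epsilon> l" using Fd b by (auto simp: W_def)
    ultimately obtain c where "Q b c" using l_regular[of "\<lambda>d. app (Fd d) b" D] by (auto simp: Q_def)
    moreover have "cls \<C> (Q b)" unfolding Q_def by (intro cl cfn_comp[OF fam_C cFd])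
    ultimately show ?thesis using lst(2)[of "Q b" c] Ord_mem_l by (auto simp: Q_def)
  qed
  have "cfn \<C> (\<lambda>b. lst (Q b))" unfolding Q_def by (intro cl cfn_comp[OF fam_C cFd])
  moreover have "\<And>b. b \<epsilon> l \<Longrightarrow> lst (Q b) \<epsilon> l" using Q by (auto simp: Q_def)
  ultimately obtain x where x: "x \<epsilon> l" "a \<epsilon> x" "cofw x" "\<And>b. b \<epsilon> x \<Longrightarrow> lst (Q b) \<epsilon> x"
    using ex_closed_point[of "\<lambda>b. lst (Q b)", OF _ _ a] by blast
  define d where "d = app (einj x) a"
  have d: "d \<epsilon> D" using inj_into_einj[OF l_small[OF x(1)]] x(2) by (simp add: inj_into_def d_def)
  have "app (Fd d) b \<epsilon> x" if "b \<epsilon> x" for b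
  proof -
    have "app (Fd d) b \<epsilon> lst (Q b)" using Q[OF l_trans[OF x(1) that]] d by (simp add: Q_def)
    then show ?thesis using x(4)[OF that] Ord_trans[OF Ord_mem_l[OF x(1)]] by blast
  qed
  moreover have "ulam d a x" using x by (simp add: ulam_def d_def)
  ultimately show False using Fd[OF d] x unfolding W_def by blast
qed

text \<open>Pigeonhole: if in every row the stationary entries were bounded, regularity would bound
  them all by one \<open>b\<close>, yet column \<open>b\<close> has a stationary entry.\<close>

lemma ulam_row:
  "\<exists>d. d \<epsilon> D \<and> (\<forall>b. b \<epsilon> l \<longrightarrow> (\<exists>a. a \<epsilon> l \<and> b \<epsilon> a \<and> stationary l (ulam d a)))"
proof (rule ccontr)
  assume n: "\<not> ?thesis"
  define Q where "Q d b \<longleftrightarrow> b \<epsilon> l \<and> (\<forall>a. a \<epsilon> l \<longrightarrow> stationary l (ulam d a) \<longrightarrow> \<not> b \<epsilon> a)" for d b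
  have Q: "Q d (lst (Q d))" if d: "d \<epsilon> D" for d
  proof -
    obtain b where "Q d b" using n d unfolding Q_def by blast
    moreover have "cls \<C> (Q d)" unfolding Q_def by (intro cl)
    ultimately show ?thesis using lst(2)[of "Q d" b] Ord_mem_l by (auto simp: Q_def)
  qed
  have "small D" by (rule small_in_D)
  moreover have "cfn \<C> (\<lambda>d. lst (Q d))" unfolding Q_def by (intro cl)
  moreover have "\<And>d. d \<epsilon> D \<Longrightarrow> lst (Q d) \<epsilon> l" using Q by (auto simp: Q_def)
  ultimately obtain b where b: "b \<epsilon> l" "\<And>d. d \<epsilon> D \<Longrightarrow> lst (Q d) \<epsilon> b"
    using l_regular[of "\<lambda>d. lst (Q d)" D] by blast
  obtain d where "d \<epsilon> D" "stationary l (ulam d b)" using ulam_stationary[OF b(1)] by blast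
  then show False using Q[of d] b unfolding Q_def by blast
qed

text \<open>\<open>D\<close> is enumerated along \<open>H\<close> without repetition until
  exhausted. If some \<open>u\<close> were never reached, \<open>H\<close> would inject into
  \<open>D\<close> and hence be bounded.\<close>

lemma unbounded_onto_D:
  assumes H: "\<And>a. a \<epsilon> H \<Longrightarrow> a \<epsilon> l" "\<And>b. b \<epsilon> l \<Longrightarrow> \<exists>a. a \<epsilon> H \<and> b \<epsilon> a"
  shows "\<exists>k. cfn \<C> k \<and> (\<forall>u. u \<epsilon> D \<longrightarrow> (\<exists>a. a \<epsilon> H \<and> k a = u))"
proof -
  \<comment> \<open>The default \<open>D\<close> is not a member of \<open>D\<close>; it marks
    arguments outside \<open>H\<close> and the end of the enumeration.\<close>
  define G where "G a w = (if a \<epsilon> H \<and> (\<exists>d. d \<epsilon> D \<and> \<not> d \<epsilon> w) then ch (sep D (\<lambda>d. \<not> d \<epsilon> w)) else D)" for a w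
  define k where "k = recur G"
  have G: "cfn \<C> (\<lambda>p. G (p1 p) (p2 p))" unfolding G_def by (intro cl)
  have k: "cfn \<C> k" unfolding k_def by (rule cfn_recur[OF G])
  have k_eq: "k a = G a (img k a)" if "a \<epsilon> l" for a
    unfolding k_def using recur[OF G] Ord_mem_l that by blast
  have kH: "a \<epsilon> H" if "a \<epsilon> l" "k a \<epsilon> D" for a
    using that k_eq[OF that(1)] mem_irrefl[of D] by (auto simp: G_def split: if_splits)
  have "\<exists>a. a \<epsilon> H \<and> k a = u" if u: "u \<epsilon> D" for u
  proof (rule ccontr)
    assume n: "\<nexists>a. a \<epsilon> H \<and> k a = u"
    have ka: "k a \<epsilon> D" "\<And>b. b \<epsilon> a \<Longrightarrow> k b \<noteq> k a" if a: "a \<epsilon> H" for a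
    proof -
      have s: "cls \<C> (\<lambda>d. \<not> d \<epsilon> img k a)" by (intro cl cfn_comp[OF fam_C k])
      have ex: "\<not> u \<epsilon> img k a"
      proof
        assume "u \<epsilon> img k a"
        then obtain b where b: "b \<epsilon> a" "k b = u" using k by auto
        then have "b \<epsilon> H" using kH[of b] u l_trans H(1) a by blast
        then show False using n b by blast
      qed
      then have "k a = ch (sep D (\<lambda>d. \<not> d \<epsilon> img k a))"
        using k_eq[OF H(1)[OF a]] a u by (auto simp: G_def)
      moreover have "u \<epsilon> sep D (\<lambda>d. \<not> d \<epsilon> img k a)" using u ex mem_sep[OF s] by blast
      ultimately have "k a \<epsilon> D \<and> \<not> k a \<epsilon> img k a" using ch_mem mem_sep[OF s] by metis
      then show "k a \<epsilon> D" "\<And>b. b \<epsilon> a \<Longrightarrow> k b \<noteq> k a" using k by auto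
    qed
    have "small H"
    proof (rule smallI[OF k])
      show "a = b" if "a \<epsilon> H" "b \<epsilon> H" "k a = k b" for a b
        using ka(2) that Ord_linear[of a b] H(1) Ord_mem_l by metis
    qed (use ka in blast)
    moreover have "cfn \<C> (\<lambda>a. a)" by (intro cl)
    ultimately obtain b where "b \<epsilon> l" "\<And>a. a \<epsilon> H \<Longrightarrow> a \<epsilon> b"
      using l_regular[of "\<lambda>a. a" H] H(1) by blast
    then show False using H(2) mem_asym by blast
  qed
  then show ?thesis using k by blast
qed

text \<open>The entries of one row are disjoint since each \<open>einj x\<close> is injective. The
  map \<open>k\<close> from stationary columns onto \<open>D\<close> merges them into fibres, each
  containing a stationary entry; leftover points go to \<open>emp\<close>.\<close>

lemma ex_stationary_partition:
  "\<exists>g. cfn \<C> g \<and> (\<forall>x. g x \<epsilon> D) \<and> (\<forall>u. u \<epsilon> D \<longrightarrow> stationary l (\<lambda>x. g x = u))"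
proof -
  obtain d where d: "d \<epsilon> D"
    "\<And>b. b \<epsilon> l \<Longrightarrow> \<exists>a. a \<epsilon> l \<and> b \<epsilon> a \<and> stationary l (ulam d a)" using ulam_row by blast
  define H where "H = sep l (\<lambda>a. stationary l (ulam d a))"
  have "cls \<C> (\<lambda>a. stationary l (ulam d a))" by (intro cl)
  then have H: "a \<epsilon> H \<longleftrightarrow> a \<epsilon> l \<and> stationary l (ulam d a)" for a by (simp add: H_def)
  obtain k where k: "cfn \<C> k" "\<And>u. u \<epsilon> D \<Longrightarrow> \<exists>a. a \<epsilon> H \<and> k a = u"
    using unbounded_onto_D[of H] H d by blast
  define e where "e x = the1 (\<lambda>a. a \<epsilon> H \<and> ulam d a x)" for x
  define g where "g x = (if k (e x) \<epsilon> D then k (e x) else emp)" for x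
  have "cfn \<C> g" unfolding g_def e_def by (intro cl cfn_comp[OF fam_C k(1)])
  moreover have "g x \<epsilon> D" for x using omega_D emp_omega by (simp add: g_def)
  moreover have "stationary l (\<lambda>x. g x = u)" if u: "u \<epsilon> D" for u
  proof -
    obtain a where a: "a \<epsilon> H" "k a = u" using k u by blast
    have "g x = u" if x: "x \<epsilon> l" "ulam d a x" for x
    proof -
      have "e x = a"
        unfolding e_def
      proof (rule the1_equality)
        show "b = a" if "b \<epsilon> H \<and> ulam d b x" for b
          using inj_into_einj[OF l_small[OF x(1)]] that x(2) by (auto simp: ulam_def inj_into_def)
      qed (use a x in blast)
      then show ?thesis using a u by (simp add: g_def)
    qed
    then show ?thesis using a(1) unfolding H stationary_def by metis
  qed
  ultimately show ?thesis by blast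
qed

section \<open>The range of the embedding\<close>

text \<open>If \<open>x\<close> in the fibre of \<open>u\<close> is closed under a suitable
  function, then \<open>j x\<close> has cofinality omega, is closed under the given
  \<open>F\<close>, and lies in the fibre of \<open>j(g)\<close> over \<open>j u\<close>.\<close>

lemma j_image_subset:
  assumes g: "cfn \<C> g" and st: "stationary l (\<lambda>x. g x = u)"
  shows "stationary l (\<lambda>x. pr x (j u) \<epsilon> j (lam g l))"
  unfolding stationary_def
proof (intro allI impI)
  fix F assume F: "\<forall>a. a \<epsilon> l \<longrightarrow> app F a \<epsilon> l"
  \<comment> \<open>Chosen so that closure of \<open>x\<close> under the least such \<open>b\<close>
    becomes closure of \<open>j x\<close> under \<open>F\<close>, by continuity of \<open>j\<close>
    at \<open>x\<close>.\<close>
  define Q where "Q a b \<longleftrightarrow> b \<epsilon> l \<and> (\<forall>c. c \<epsilon> j a \<longrightarrow> app F c \<epsilon> j b)" for a b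
  have Q: "Q a (lst (Q a))" if a: "a \<epsilon> l" for a
  proof -
    have ja: "j a \<epsilon> l" using a j_mem_l by blast
    have "cfn \<C> (app F)" by (intro cl)
    moreover have "\<And>c. c \<epsilon> j a \<Longrightarrow> app F c \<epsilon> l" using F l_trans[OF ja] by blast
    ultimately obtain b where b: "b \<epsilon> l" "\<And>c. c \<epsilon> j a \<Longrightarrow> app F c \<epsilon> b"
      using l_regular[of "app F" "j a"] l_small[OF ja] by blast
    have "Ord (j (suc b))" using b(1) suc_l j_mem_l Ord_mem_l by blast
    then have "Q a (suc b)"
      unfolding Q_def using b suc_l mem_j_suc[OF b(1)] Ord_trans by blast
    moreover have "cls \<C> (Q a)" unfolding Q_def by (intro cl)
    ultimately show ?thesis using lst(2)[of "Q a" "suc b"] suc_l[OF b(1)] Ord_mem_l by blast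
  qed
  have "cfn \<C> (\<lambda>a. lst (Q a))" unfolding Q_def by (intro cl)
  moreover have "\<And>a. a \<epsilon> l \<Longrightarrow> lst (Q a) \<epsilon> l" using Q by (auto simp: Q_def)
  ultimately obtain x where x: "x \<epsilon> l" "cofw x" "\<And>a. a \<epsilon> x \<Longrightarrow> lst (Q a) \<epsilon> x" "g x = u"
    using stationaryD[OF st _ _ Ord_l, of "\<lambda>a. lst (Q a)"] by blast
  obtain s where s: "\<And>n. n \<epsilon> omega \<Longrightarrow> app s n \<epsilon> x"
    "\<And>z. z \<epsilon> x \<Longrightarrow> \<exists>n. n \<epsilon> omega \<and> z \<epsilon> app s n" using x(2) unfolding cofw_def by blast
  have "cfn \<C> (app s)" by (intro cl)
  note cover = j_omega_cover[OF this s(2)]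
  have "cofw (j x)"
  proof (rule cofwI)
    show "cfn \<C> (\<lambda>n. j (app s n))" by (intro cl)
  qed (use s(1) cover in auto)
  moreover have "app F c \<epsilon> j x" if c: "c \<epsilon> j x" for c
  proof -
    obtain n where n: "n \<epsilon> omega" "c \<epsilon> j (app s n)" using cover c by blast
    let ?a = "app s n"
    have a: "?a \<epsilon> x" "?a \<epsilon> l" using s(1) n l_trans[OF x(1)] by blast+
    have "app F c \<epsilon> j (lst (Q ?a))" using Q[OF a(2)] n by (simp add: Q_def)
    moreover have "j (lst (Q ?a)) \<epsilon> j x" using x(3)[OF a(1)] by simp
    ultimately show ?thesis using Ord_trans j_Ord Ord_mem_l[OF x(1)] by blast
  qed
  moreover have "pr (j x) (j u) \<epsilon> j (lam g l)"
  proof -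
    have "pr x u \<epsilon> lam g l" using g x by auto
    then have "j (pr x u) \<epsilon> j (lam g l)" by (simp only: j_mem)
    then show ?thesis by (simp only: j_pr)
  qed
  ultimately show "\<exists>x. x \<epsilon> l \<and> cofw x \<and> (\<forall>a. a \<epsilon> x \<longrightarrow> app F a \<epsilon> x) \<and> pr x (j u) \<epsilon> j (lam g l)"
    using x(1) j_mem_l by blast
qed

text \<open>A stationary fibre contains a point of cofinality omega closed under the map sending
  \<open>a\<close> to \<open>j\<close> of the least \<open>b\<close> with \<open>a\<close> in
  \<open>j b\<close>. Such a point is \<open>j y\<close> for some \<open>y\<close>, so its value
  \<open>v\<close> under \<open>j(g)\<close> is \<open>j (g y)\<close>.\<close>

lemma j_image_superset:
  assumes g: "cfn \<C> g" "\<And>x. g x \<epsilon> D" and v: "v \<epsilon> j D"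
    and st: "stationary l (\<lambda>x. pr x v \<epsilon> j (lam g l))"
  shows "\<exists>u. u \<epsilon> D \<and> v = j u"
proof -
  define Q where "Q a b \<longleftrightarrow> b \<epsilon> l \<and> a \<epsilon> j b" for a b
  define r where "r a = lst (Q a)" for a
  have cr: "cfn \<C> r" unfolding r_def Q_def by (intro cl)
  have r: "r a \<epsilon> l" "a \<epsilon> j (r a)" if a: "a \<epsilon> l" for a
  proof -
    have "Q a (suc a)" using a suc_l mem_j_suc by (simp add: Q_def)
    moreover have "cls \<C> (Q a)" unfolding Q_def by (intro cl)
    ultimately show "r a \<epsilon> l" "a \<epsilon> j (r a)"
      using lst(2)[of "Q a" "suc a"] suc_l[OF a] Ord_mem_l by (auto simp: r_def Q_def)
  qed
  have "cfn \<C> (\<lambda>a. j (r a))" by (intro cl cr)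
  moreover have "\<And>a. a \<epsilon> l \<Longrightarrow> j (r a) \<epsilon> l" using r j_mem_l by blast
  ultimately obtain x where x: "x \<epsilon> l" "cofw x" "\<And>a. a \<epsilon> x \<Longrightarrow> j (r a) \<epsilon> x" "pr x v \<epsilon> j (lam g l)"
    using stationaryD[OF st _ _ Ord_l, of "\<lambda>a. j (r a)"] by blast
  have Ox: "Ord x" using x Ord_mem_l by blast
  obtain s where s: "\<And>n. n \<epsilon> omega \<Longrightarrow> app s n \<epsilon> x"
    "\<And>z. z \<epsilon> x \<Longrightarrow> \<exists>n. n \<epsilon> omega \<and> z \<epsilon> app s n" using x(2) unfolding cofw_def by blast
  have sl: "app s n \<epsilon> l" if "n \<epsilon> omega" for n using s(1)[OF that] l_trans x(1) by blast
  \<comment> \<open>The supremum of the least ordinals whose images exceed a cofinal sequence in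
    \<open>x\<close>; continuity makes its image equal to \<open>x\<close>.\<close>
  define y where "y = Uni (img (\<lambda>n. r (app s n)) omega)"
  have rs: "cfn \<C> (\<lambda>n. r (app s n))" by (intro cl cfn_comp[OF fam_C cr])
  then have y: "z \<epsilon> y \<longleftrightarrow> (\<exists>n. n \<epsilon> omega \<and> z \<epsilon> r (app s n))" for z
    by (auto simp: y_def)
  have "j y = x"
  proof (rule ext)
    fix w
    show "w \<epsilon> j y \<longleftrightarrow> w \<epsilon> x"
    proof
      assume "w \<epsilon> j y"
      then obtain n where "n \<epsilon> omega" "w \<epsilon> j (r (app s n))"
        using j_omega_cover[OF rs] y by blast
      then show "w \<epsilon> x" using x(3) s(1) Ord_trans[OF Ox] by blast
    next
      assume "w \<epsilon> x"
      then obtain n where n: "n \<epsilon> omega" "w \<epsilon> app s n" using s(2) by blast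
      have "Ord (j (r (app s n)))" using r(1)[OF sl[OF n(1)]] Ord_mem_l j_Ord by blast
      then have "w \<epsilon> j (r (app s n))" using r(2)[OF sl[OF n(1)]] n Ord_trans by blast
      then show "w \<epsilon> j y" using y n by (intro j_subset[of "r (app s n)" y]) blast+
    qed
  qed
  then have yl: "y \<epsilon> l" using x(1) j_mem_l by metis
  then have "pr y (g y) \<epsilon> lam g l" using g by auto
  then have "j (pr y (g y)) \<epsilon> j (lam g l)" by (simp only: j_mem)
  then have jg: "pr x (j (g y)) \<epsilon> j (lam g l)" by (simp only: j_pr \<open>j y = x\<close>)
  have "v = j (g y)"
  proof (rule j_single_valued[OF _ _ v _ x(4) jg])
    show "b = b'" if "pr a b \<epsilon> lam g l" "pr a b' \<epsilon> lam g l" for a b b'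
      using that g(1) by simp
    show "x \<epsilon> j l" using x(1) by (simp only: j_l)
    show "j (g y) \<epsilon> j D" using g(2) by (simp only: j_mem)
  qed
  then show ?thesis using g(2) by blast
qed

end

context NGBC
begin

text \<open>Here \<open>c\<close> codes \<open>j x\<close>, \<open>j D\<close>, \<open>l\<close> and \<open>j\<close> of a stationary partition of \<open>l\<close> indexed by \<open>D\<close>;
  the predicate says that \<open>x\<close> is the image of \<open>j x\<close> under the transitive collapse of \<open>j\<close>''\<open>D\<close>.\<close>

definition in_range :: "'v \<Rightarrow> 'v \<Rightarrow> bool" where
  "in_range c v \<longleftrightarrow> v \<epsilon> p1 (p2 c) \<and>
     stationary (p1 (p2 (p2 c))) (\<lambda>x. pr x v \<epsilon> p2 (p2 (p2 c)))"

definition collapses :: "'v \<Rightarrow> 'v \<Rightarrow> bool" where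
  "collapses x c \<longleftrightarrow> (\<exists>d f. transitive_set E d \<and> x \<epsilon> d \<and>
     (\<forall>u v. u \<epsilon> d \<longrightarrow> v \<epsilon> d \<longrightarrow> (u \<epsilon> v \<longleftrightarrow> app f u \<epsilon> app f v)) \<and>
     (\<forall>u. u \<epsilon> d \<longrightarrow> in_range c (app f u)) \<and>
     (\<forall>v. in_range c v \<longrightarrow> (\<exists>u. u \<epsilon> d \<and> v = app f u)) \<and>
     app f x = p1 c)"

text \<open>The closure rules hold for every \<open>fam\<close>, hence for \<open>C0\<close>: the
  predicate involves no class, no choice and no parameter beyond its two arguments.\<close>

lemma cls_collapses: "cls C0 (\<lambda>p. collapses (p1 p) (p2 p))"
  unfolding collapses_def in_range_def by (intro cl)

text \<open>Variable 1 carries the parameter. The class of codes of \<open>R\<close> is turned into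
  a formula by \<open>csat_C0\<close>.\<close>

lemma definable_fromI:
  assumes "cls C0 (\<lambda>p. R (p1 p) (p2 p))" "R x a" "\<And>y. R y a \<Longrightarrow> y = x"
  shows "definable_from E {a} x"
proof -
  let ?X = "{p. R (p1 p) (p2 p)}" and ?p = "Ex 2 (And (OpairF 0 1 2) (InCls 2 0))"
  have "range (\<lambda>_::nat. ?X) \<subseteq> C0" using assms(1) by (auto simp: cls_def)
  from csat_C0[OF this, of ?p] obtain q where q: "set_formula q" "fv q \<subseteq> fv ?p"
    "\<And>s. sat UNIV E s q = csat UNIV E (\<lambda>_. ?X) s ?p" by blast
  have "fv q - {0} \<subseteq> {1}" using q(2) by (auto simp: fv_OpairF)
  moreover have "sat UNIV E ((\<lambda>_. a)(0 := y)) q \<longleftrightarrow> R y a" for y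
    unfolding q(3) by simp
  then have "sat UNIV E ((\<lambda>_. a)(0 := y)) q \<longleftrightarrow> y = x" for y
    using assms(2,3) by blast
  ultimately show ?thesis
    unfolding definable_from_def using q(1) by (intro exI[of _ q] exI[of _ "\<lambda>_. a"]) auto
qed

end

section \<open>Recovering a set from a parameter in the range of \<open>j\<close>\<close>

context embedded
begin

lemma definable_from_range: "\<exists>a. definable_from E {j a} x"
proof -
  obtain D where D: "x \<epsilon> D" "transitive_set E D" "\<And>a b. a \<epsilon> D \<Longrightarrow> b \<epsilon> D \<Longrightarrow> pr a b \<epsilon> D"
    "\<And>n. n \<epsilon> omega \<Longrightarrow> n \<epsilon> D" "\<And>z. z \<epsilon> j D \<Longrightarrow> z \<epsilon> D" using ex_closed_set[of x] by metis
  interpret closed_set E \<C> M j D by unfold_locales (use D in blast)+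
  obtain g where g: "cfn \<C> g" "\<And>x. g x \<epsilon> D" "\<And>u. u \<epsilon> D \<Longrightarrow> stationary l (\<lambda>x. g x = u)"
    using ex_stationary_partition by blast
  \<comment> \<open>One tuple holds all the data. Since \<open>j\<close> fixes \<open>l\<close>, the
    image tuple contains \<open>l\<close> itself, on which stationarity is computed.\<close>
  define a where "a = pr x (pr D (pr l (lam g l)))"
  have ja: "j a = pr (j x) (pr (j D) (pr l (j (lam g l))))" by (simp add: a_def j_pr j_l)
  have range: "in_range (j a) v \<longleftrightarrow> (\<exists>u. u \<epsilon> D \<and> v = j u)" for v
    unfolding in_range_def ja p1_pr p2_pr
    using j_image_superset[OF g(1,2)] j_image_subset[OF g(1) g(3)] by auto
  have app_j: "app (lam j D) u = j u" if "u \<epsilon> D" for u using that cfn_j by simp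
  have "collapses x (j a)"
    unfolding collapses_def range
  proof (rule exI[of _ D], rule exI[of _ "lam j D"], intro conjI allI impI)
    show "app (lam j D) x = p1 (j a)" using app_j D(1) by (simp only: ja p1_pr)
    show "u \<epsilon> v \<longleftrightarrow> app (lam j D) u \<epsilon> app (lam j D) v" if "u \<epsilon> D" "v \<epsilon> D" for u v
      using that by (simp only: app_j j_mem)
    show "\<exists>w. w \<epsilon> D \<and> app (lam j D) u = j w" if "u \<epsilon> D" for u using that app_j by blast
    show "\<exists>u. u \<epsilon> D \<and> v = app (lam j D) u" if "\<exists>u. u \<epsilon> D \<and> v = j u" for v
      using that app_j by metis
  qed (fact D(1,2))+
  moreover have "y = x" if y: "collapses y (j a)" for y
  proof -
    obtain d f where df: "transitive_set E d \<and> y \<epsilon> d \<and>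
      (\<forall>u v. u \<epsilon> d \<longrightarrow> v \<epsilon> d \<longrightarrow> (u \<epsilon> v \<longleftrightarrow> app f u \<epsilon> app f v)) \<and>
      (\<forall>u. u \<epsilon> d \<longrightarrow> (\<exists>w. w \<epsilon> D \<and> app f u = j w)) \<and>
      (\<forall>v. (\<exists>w. w \<epsilon> D \<and> v = j w) \<longrightarrow> (\<exists>u. u \<epsilon> d \<and> v = app f u)) \<and> app f y = p1 (j a)"
      using y[unfolded collapses_def range] by (elim exE) (rule that)
    then have d: "transitive_set E d" "y \<epsilon> d"
      and f: "\<And>u v. u \<epsilon> d \<Longrightarrow> v \<epsilon> d \<Longrightarrow> u \<epsilon> v \<longleftrightarrow> app f u \<epsilon> app f v"
      and fj: "\<And>u. u \<epsilon> d \<Longrightarrow> \<exists>w. w \<epsilon> D \<and> app f u = j w"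
      by blast+
    have jf: "\<exists>u. u \<epsilon> d \<and> j w = app f u" if "w \<epsilon> D" for w using df that by blast
    have fy: "app f y = j x" using df by (simp add: ja)
    \<comment> \<open>Uniqueness of the transitive collapse: \<open>D\<close> and \<open>d\<close>
      are transitive and isomorphic to the same set of images, so elements with equal image
      coincide.\<close>
    have "u \<epsilon> D \<longrightarrow> (\<forall>v. v \<epsilon> d \<longrightarrow> app f v = j u \<longrightarrow> u = v)" for u
    proof (rule eps_induct[of _ u])
      show "cls \<C> (\<lambda>u. u \<epsilon> D \<longrightarrow> (\<forall>v. v \<epsilon> d \<longrightarrow> app f v = j u \<longrightarrow> u = v))" by (intro cl)
      fix u assume IH: "\<And>z. z \<epsilon> u \<Longrightarrow> z \<epsilon> D \<longrightarrow> (\<forall>v. v \<epsilon> d \<longrightarrow> app f v = j z \<longrightarrow> z = v)"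
      show "u \<epsilon> D \<longrightarrow> (\<forall>v. v \<epsilon> d \<longrightarrow> app f v = j u \<longrightarrow> u = v)"
      proof (intro impI allI ext)
        fix v z assume u: "u \<epsilon> D" and v: "v \<epsilon> d" "app f v = j u"
        show "z \<epsilon> u \<longleftrightarrow> z \<epsilon> v"
        proof
          assume z: "z \<epsilon> u"
          then have zD: "z \<epsilon> D" using u D(2) unfolding transitive_set_def by blast
          then obtain w where w: "w \<epsilon> d" "j z = app f w" using jf by blast
          moreover have "w \<epsilon> v" using f[OF w(1) v(1)] w v z j_mem by metis
          ultimately show "z \<epsilon> v" using IH[OF z] zD by metis
        next
          assume z: "z \<epsilon> v"
          then have zd: "z \<epsilon> d" using v d(1) unfolding transitive_set_def by blast
          then obtain w where w: "w \<epsilon> D" "app f z = j w" using fj by blast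
          moreover have "w \<epsilon> u" using f[OF zd v(1)] w v z j_mem by metis
          ultimately show "z \<epsilon> u" using IH zd by metis
        qed
      qed
    qed
    then show ?thesis using D(1) d(2) fy by blast
  qed
  ultimately show ?thesis using definable_fromI[OF cls_collapses] by blast
qed

end

lemma definable_from_mono: "definable_from E A x \<Longrightarrow> A \<subseteq> B \<Longrightarrow> definable_from E B x"
  unfolding definable_from_def by blast

theorem theorem12:
  fixes E :: "'v \<Rightarrow> 'v \<Rightarrow> bool" and \<C> :: "'v set set"
    and M :: "'v set" and j :: "'v \<Rightarrow> 'v"
  assumes "NGBC E \<C>"
    and "inner_model E \<C> M"
    and "elementary_embedding E \<C> j M"
  shows "HOD E M = UNIV
    \<and> (\<forall>x. definable_from E ({a. ordinal E a} \<union> M) x)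
    \<and> (\<forall>x. \<exists>a. definable_from E {j a} x)"
proof -
  interpret embedded E \<C> M j
    using assms by (intro embedded.intro embedded_axioms.intro)
  have all: "definable_from E ({a. ordinal E a} \<union> M) x" for x
  proof -
    obtain a where "definable_from E {j a} x" using definable_from_range[of x] ..
    moreover have "j a \<in> M" using assms(3) by (auto simp: elementary_embedding_def)
    then have "{j a} \<subseteq> {a. ordinal E a} \<union> M" by simp
    ultimately show ?thesis by (rule definable_from_mono)
  qed
  then have "OD E M = UNIV" by (simp add: OD_def)
  then have "HOD E M = UNIV" by (simp add: HOD_def)
  then show ?thesis using all definable_from_range by (intro conjI allI)
qed

end
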